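(* Let $n>1$ be an integer, let $B$ be the unit ball of $\mathbf{C}^n$, and let $\varphi$ be holomorphic on $B$. Let $1<p<\infty$ and $0\le\sigma<\infty$ with $1+\sigma>\frac{n}{p}$. Then the following conditions are equivalent: (i) The operator $V_\varphi:B_p^\sigma(B)\to B_p^\sigma(B)$ is bounded. (ii) The positive Borel measure $\mu_\varphi$ on $B$ defined by $$d\mu_\varphi(z)=|R\varphi(z)|^p(1-|z|^2)^{p+\sigma p-n-1}\,dv(z)$$ is a Carleson measure for $B_p^\sigma(B)$.
   Context: $B=\{z\in\mathbf{C}^n:|z|<1\}$, $dv$ is Lebesgue measure on $B$ normalized by $v(B)=1$, $d\lambda(z)=(1-|z|^2)^{-n-1}dv(z)$, and $H(B)$ is the space of holomorphic functions on $B$. For $f\in H(B)$ the radial derivative is $Rf(z)=\sum_{j=1}^n z_j\frac{\partial f}{\partial z_j}(z)$. For $1<p<\infty$, $0\le\sigma<\infty$ with $1+\sigma>n/p$, the Besov-Sobolev space $B_p^\sigma(B)$ is the Banach space of $f\in H(B)$ with $$\|f\|_{B_p^\sigma(B)}=\left\{|f(0)|^p+\int_B|(1-|z|^2)^{1+\sigma}f'(z)|^p\,d\lambda(z)\right\}^{1/p}<\infty,$$ where $f'$ is the first order complex derivative (the complex gradient $(\partial f/\partial z_1,\dots,\partial f/\partial z_n)$); the norm is considered up to equivalence. A positive Borel measure $\mu$ on $B$ is a Carleson measure for $B_p^\sigma(B)$ if there is a constant $C>0$ such that $\int_B|f(z)|^p\,d\mu(z)\le C\|f\|_{B_p^\sigma(B)}^p$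 for all $f\in B_p^\sigma(B)$. The Riemann-Stieltjes operator $V_\varphi$ with symbol $\varphi\in H(B)$ is defined for $f\in H(B)$ by $$V_\varphi f(z)=\int_0^1 f(tz)\,R\varphi(tz)\,\frac{dt}{t},\qquad z\in B.$$ *)

theory Defs
  imports "HOL-Analysis.Analysis"
begin

abbreviation unit_ball :: "(complex ^ 'n::finite) set" where
  "unit_ball \<equiv> ball 0 1"

text \<open>Functions on the ball are represented by total functions; their values outside
  the ball play no role in any of the notions below.  Holomorphy is Frechet
  differentiability with a complex-linear derivative (every complex-linear functional
  on complex n-space is of the form below).\<close>

definition holomorphic_ball :: "(complex ^ 'n::finite \<Rightarrow> complex) \<Rightarrow> bool" where
  "holomorphic_ball f \<longleftrightarrow>
     (\<forall>z\<in>unit_ball. \<exists>c :: complex ^ 'n.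
        (f has_derivative (\<lambda>h. \<Sum>j\<in>UNIV. c $ j * h $ j)) (at z))"

definition complex_partial ::
    "'n \<Rightarrow> (complex ^ 'n::finite \<Rightarrow> complex) \<Rightarrow> complex ^ 'n \<Rightarrow> complex" where
  "complex_partial j f z = deriv (\<lambda>w. f (z + axis j w)) 0"

definition complex_gradient ::
    "(complex ^ 'n::finite \<Rightarrow> complex) \<Rightarrow> complex ^ 'n \<Rightarrow> complex ^ 'n" where
  "complex_gradient f z = (\<chi> j. complex_partial j f z)"

definition radial_deriv ::
    "(complex ^ 'n::finite \<Rightarrow> complex) \<Rightarrow> complex ^ 'n \<Rightarrow> complex" where
  "radial_deriv f z = (\<Sum>j\<in>UNIV. z $ j * complex_partial j f z)"

lemma complex_partial_eq:
  fixes f :: "complex ^ 'n::finite \<Rightarrow> complex"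
  assumes "(f has_derivative (\<lambda>h. \<Sum>k\<in>UNIV. c $ k * h $ k)) (at z)"
  shows "complex_partial j f z = c $ j"
proof -
  have lin: "bounded_linear (axis j :: complex \<Rightarrow> complex ^ 'n)"
    by (rule linear_conv_bounded_linear[THEN iffD1], rule linearI)
       (auto simp: axis_def vec_eq_iff)
  have d: "((\<lambda>w. z + axis j w) has_derivative axis j) (at (0::complex))"
    using has_derivative_add[OF has_derivative_const
      bounded_linear.has_derivative[OF lin has_derivative_ident]] by simp
  have z: "z + axis j (0::complex) = z" by (simp add: axis_def vec_eq_iff)
  have "((\<lambda>w. f (z + axis j w)) has_derivative
      (\<lambda>w. \<Sum>k\<in>UNIV. c $ k * axis j w $ k)) (at 0)"
    using has_derivative_compose[OF d, of f "\<lambda>h. \<Sum>k\<in>UNIV. c $ k * h $ k"] assms z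
    by simp
  moreover have "(\<lambda>w. \<Sum>k\<in>UNIV. c $ k * axis j w $ k) = (*) (c $ j)"
    by (simp add: axis_def if_distrib fun_eq_iff cong: if_cong)
  ultimately have "((\<lambda>w. f (z + axis j w)) has_field_derivative c $ j) (at 0)"
    by (simp add: has_field_derivative_def)
  then show ?thesis
    unfolding complex_partial_def by (rule DERIV_imp_deriv)
qed

definition ball_measure :: "(complex ^ 'n::finite) measure" where
  "ball_measure =
     scale_measure (1 / emeasure lborel (unit_ball :: (complex ^ 'n) set))
       (restrict_space lborel unit_ball)"

lemma emeasure_ball_measure:
  "emeasure ball_measure (unit_ball :: (complex ^ 'n::finite) set) = 1"
proof -
  let ?B = "unit_ball :: (complex ^ 'n) set"
  have "emeasure lborel ?B \<noteq> 0" "emeasure lborel ?B \<noteq> \<infinity>"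
    using emeasure_lborel_ball_finite[of "0 :: complex ^ 'n" 1]
    by (simp_all add: emeasure_ball less_top unit_ball_vol_pos less_imp_neq[symmetric])
  then show ?thesis
    by (simp add: ball_measure_def emeasure_restrict_space ennreal_divide_times
        ennreal_divide_self less_top)
qed

definition invariant_measure :: "(complex ^ 'n::finite) measure" where
  "invariant_measure =
     density ball_measure (\<lambda>z. ennreal ((1 - (norm z)\<^sup>2) powr (- real CARD('n) - 1)))"

definition besov_integral :: "real \<Rightarrow> real \<Rightarrow> (complex ^ 'n::finite \<Rightarrow> complex) \<Rightarrow> ennreal" where
  "besov_integral p \<sigma> f =
     (\<integral>\<^sup>+ z. ennreal (((1 - (norm z)\<^sup>2) powr (1 + \<sigma>) * norm (complex_gradient f z)) powr p)
        \<partial>invariant_measure)"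

definition besov_space :: "real \<Rightarrow> real \<Rightarrow> (complex ^ 'n::finite \<Rightarrow> complex) set" where
  "besov_space p \<sigma> = {f. holomorphic_ball f \<and> besov_integral p \<sigma> f < \<infinity>}"

text \<open>Only meaningful for members of the space: \<^const>\<open>enn2real\<close> sends infinity to 0.\<close>

definition besov_norm :: "real \<Rightarrow> real \<Rightarrow> (complex ^ 'n::finite \<Rightarrow> complex) \<Rightarrow> real" where
  "besov_norm p \<sigma> f = (norm (f 0) powr p + enn2real (besov_integral p \<sigma> f)) powr (1 / p)"

definition besov_bounded ::
    "real \<Rightarrow> real \<Rightarrow> ((complex ^ 'n::finite \<Rightarrow> complex) \<Rightarrow> (complex ^ 'n \<Rightarrow> complex)) \<Rightarrow> bool" where
  "besov_bounded p \<sigma> T \<longleftrightarrow>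
     (\<forall>f\<in>besov_space p \<sigma>. T f \<in> besov_space p \<sigma>) \<and>
     (\<exists>C>0. \<forall>f\<in>besov_space p \<sigma>. besov_norm p \<sigma> (T f) \<le> C * besov_norm p \<sigma> f)"

definition carleson_measure :: "real \<Rightarrow> real \<Rightarrow> (complex ^ 'n::finite) measure \<Rightarrow> bool" where
  "carleson_measure p \<sigma> \<mu> \<longleftrightarrow>
     sets \<mu> = sets (restrict_space borel unit_ball) \<and>
     (\<exists>C>0. \<forall>f\<in>besov_space p \<sigma>.
        (\<integral>\<^sup>+ z. ennreal (norm (f z) powr p) \<partial>\<mu>) \<le> ennreal (C * besov_norm p \<sigma> f powr p))"

text \<open>The integrand extends continuously to \<open>t = 0\<close>, since the radial derivative vanishes
  at the origin; the junk value of the quotient there does not affect the integral.\<close>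

definition riemann_stieltjes_op ::
    "(complex ^ 'n::finite \<Rightarrow> complex) \<Rightarrow> (complex ^ 'n \<Rightarrow> complex) \<Rightarrow> complex ^ 'n \<Rightarrow> complex" where
  "riemann_stieltjes_op \<phi> f z =
     integral {0..1} (\<lambda>t::real. f (t *\<^sub>R z) * radial_deriv \<phi> (t *\<^sub>R z) / of_real t)"

definition symbol_measure ::
    "real \<Rightarrow> real \<Rightarrow> (complex ^ 'n::finite \<Rightarrow> complex) \<Rightarrow> (complex ^ 'n) measure" where
  "symbol_measure p \<sigma> \<phi> =
     density ball_measure
       (\<lambda>z. ennreal (norm (radial_deriv \<phi> z) powr p *
          (1 - (norm z)\<^sup>2) powr (p + \<sigma> * p - real CARD('n) - 1)))"

end

theory Submission
  imports Defs "HOL-Complex_Analysis.Cauchy_Integral_Formula"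
begin

text \<open>
  Write \<open>F = V_\<phi> f\<close>, \<open>g = f R\<phi>\<close> and \<open>\<alpha> = p + \<sigma>p - n - 1\<close>.  The hypothesis \<open>1 + \<sigma> > n/p\<close> says exactly
  that \<open>\<alpha> > -1\<close>.  The operator inverts the radial derivative: \<open>RF = g\<close> and \<open>F 0 = 0\<close>.  Hence the
  integral of \<open>|f|^p\<close> against \<open>\<mu>_\<phi>\<close> is the integral of \<open>|RF|^p (1 - |z|^2)^\<alpha>\<close>, whereas the \<open>p\<close>-th power
  of the Besov norm of \<open>F\<close> is the integral of \<open>|\<nabla>F|^p (1 - |z|^2)^\<alpha>\<close>, and the theorem follows once these two integrals
  are comparable.  One inequality is the pointwise bound \<open>|RF| \<le> |\<nabla>F|\<close>.

  For the other one, \<open>\<nabla>F\<close> is recovered from \<open>g\<close> by integration along rays,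
  \<open>\<nabla>F(z) = \<integral>_0^1 (\<nabla>g)(tz) dt\<close> (\<open>has_derivative_radial_primitive\<close>).  Two estimates cancel each other.
  Differentiating \<open>g\<close> costs one power of the distance to the boundary: the integral of
  \<open>|\<nabla>g|^p (1 - |z|)^(\<alpha> + p)\<close> is at most a constant times the integral of \<open>|g|^p (1 - |z|)^\<alpha>\<close>
  (\<open>gradient_weighted_integral_le\<close>).  Integrating along rays gains it back, by an inequality of Hardy
  type (\<open>weighted_Hardy\<close>), which is where \<open>\<alpha> > -1\<close> enters.  The part of the ray near the origin is
  controlled separately by a uniform bound of \<open>\<nabla>g\<close> on the ball of radius one half.

  The loss of one power rests on a Cauchy estimate for the gradient and on the sub-mean-value
  inequality \<open>|g(w)|^p r^(2n) \<le> C \<integral>_{B(w,r)} |g|^p\<close> (\<open>norm_powr_le_ball_integral\<close>).  The latter comes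
  from the Cauchy estimate too: a holomorphic function whose weighted modulus is maximal at a point stays large
  on a ball of comparable size around that point, because its gradient there is controlled.
\<close>

section \<open>Complex gradients of holomorphic functions\<close>

text \<open>The bilinear pairing without conjugation, so that \<open>complex_dot c\<close> is the general complex-linear
  functional.\<close>

definition complex_dot :: "complex ^ 'n::finite \<Rightarrow> complex ^ 'n \<Rightarrow> complex" where
  "complex_dot c h = (\<Sum>j\<in>UNIV. c $ j * h $ j)"

lemma norm_complex_dot_le: "norm (complex_dot c h) \<le> norm c * norm h"
proof -
  have "norm (complex_dot c h) \<le> (\<Sum>j\<in>UNIV. norm (c $ j) * norm (h $ j))"
    unfolding complex_dot_def by (rule sum_norm_le) (simp add: norm_mult)
  also have "\<dots> \<le> L2_set (\<lambda>j. norm (c $ j)) UNIV * L2_set (\<lambda>j. norm (h $ j)) UNIV"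
    using L2_set_mult_ineq[of "\<lambda>j. norm (c $ j)" "\<lambda>j. norm (h $ j)" UNIV] by simp
  finally show ?thesis by (simp add: norm_vec_def)
qed

lemma bounded_bilinear_complex_dot: "bounded_bilinear complex_dot"
proof
  show "\<exists>K. \<forall>c h. norm (complex_dot c h) \<le> norm c * norm h * K"
    by (rule exI[of _ 1]) (simp add: norm_complex_dot_le)
qed (auto simp: complex_dot_def algebra_simps sum.distrib scaleR_sum_right)

lemmas bounded_linear_complex_dot = bounded_bilinear.bounded_linear_right[OF bounded_bilinear_complex_dot]

lemma complex_dot_conj: "complex_dot c (\<chi> j. cnj (c $ j)) = of_real ((norm c)\<^sup>2)"
proof -
  have "complex_dot c (\<chi> j. cnj (c $ j)) = (\<Sum>j\<in>UNIV. of_real ((norm (c $ j))\<^sup>2))"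
    by (simp add: complex_dot_def complex_norm_square flip: of_real_power)
  also have "\<dots> = of_real ((norm c)\<^sup>2)"
    by (simp add: norm_vec_def L2_set_def sum_nonneg)
  finally show ?thesis .
qed

lemma complex_dot_axis [simp]: "complex_dot c (axis j 1) = c $ j"
  by (simp add: complex_dot_def axis_def if_distrib cong: if_cong)

lemma complex_gradient_unique:
  assumes "(f has_derivative complex_dot c) (at z)"
  shows "complex_gradient f z = c"
  using complex_partial_eq[of f c z] assms
  by (simp add: complex_gradient_def vec_eq_iff complex_dot_def[abs_def])

lemma holomorphic_ball_has_derivative:
  assumes "holomorphic_ball f" "z \<in> unit_ball"
  shows "(f has_derivative complex_dot (complex_gradient f z)) (at z)"
proof -
  obtain c where "(f has_derivative complex_dot c) (at z)"
    using assms unfolding holomorphic_ball_def complex_dot_def[abs_def] by blast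
  then show ?thesis using complex_gradient_unique by metis
qed

lemma holomorphic_ballI:
  assumes "\<And>z. z \<in> unit_ball \<Longrightarrow> (f has_derivative complex_dot (c z)) (at z)"
  shows "holomorphic_ball f"
  using assms unfolding holomorphic_ball_def complex_dot_def[abs_def] by blast

lemma holomorphic_ball_continuous_on: "holomorphic_ball f \<Longrightarrow> continuous_on unit_ball f"
  by (meson continuous_at_imp_continuous_on has_derivative_continuous holomorphic_ball_has_derivative)

lemma radial_deriv_eq: "radial_deriv f z = complex_dot (complex_gradient f z) z"
  by (simp add: radial_deriv_def complex_dot_def complex_gradient_def mult.commute)

lemma bounded_linear_vscale: "bounded_linear (\<lambda>\<zeta>::complex. \<zeta> *s (u::complex^'n::finite))"
proof (rule bounded_linear_intro)
  show "norm (\<zeta> *s u) \<le> norm \<zeta> * norm u" for \<zeta>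
    by (simp add: norm_vec_def norm_mult L2_set_right_distrib)
qed (auto simp: vec_eq_iff algebra_simps)

lemma norm_vscale: "norm (\<zeta> *s u) = norm \<zeta> * norm (u::complex^'n::finite)"
  by (simp add: norm_vec_def norm_mult L2_set_right_distrib)

lemma slice_has_field_derivative:
  assumes "(f has_derivative complex_dot c) (at (w + \<zeta> *s u))"
  shows "((\<lambda>\<zeta>. f (w + \<zeta> *s u)) has_field_derivative complex_dot c u) (at \<zeta>)"
proof -
  have d: "((\<lambda>\<zeta>. w + \<zeta> *s u) has_derivative (\<lambda>\<zeta>. \<zeta> *s u)) (at \<zeta>)"
    using has_derivative_add[OF has_derivative_const
      bounded_linear.has_derivative[OF bounded_linear_vscale has_derivative_ident]] by simp
  have "((\<lambda>\<zeta>. f (w + \<zeta> *s u)) has_derivative (\<lambda>h. complex_dot c (h *s u))) (at \<zeta>)"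
    using has_derivative_compose[OF d assms] .
  moreover have "complex_dot c (h *s u) = complex_dot c u * h" for h
    by (simp add: complex_dot_def sum_distrib_left mult_ac)
  ultimately show ?thesis by (simp add: has_field_derivative_def)
qed

text \<open>The one-variable Cauchy inequality on the complex line through \<open>w\<close> in the direction conjugate to
  the gradient, where the directional derivative has modulus \<open>|c w|\<close>.  Only differentiability on the
  closed ball is assumed, so that the estimate also applies to differences of translates.\<close>

lemma norm_gradient_le:
  fixes f :: "complex ^ 'n::finite \<Rightarrow> complex"
  assumes f: "\<And>x. x \<in> cball w r \<Longrightarrow> (f has_derivative complex_dot (c x)) (at x)"
    and r: "0 < r" and M: "\<And>x. x \<in> cball w r \<Longrightarrow> norm (f x) \<le> M"
  shows "norm (c w) \<le> M / r"
proof (cases "c w = 0")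
  case True
  have "0 \<le> M" using M[of w] r order_trans[OF norm_ge_zero[of "f w"]] by simp
  then show ?thesis using True r by simp
next
  case False
  define v where "v = (\<chi> j. cnj (c w $ j))"
  define u where "u = of_real (inverse (norm (c w))) *s v"
  have "norm v = norm (c w)" by (simp add: v_def norm_vec_def)
  then have nu: "norm u = 1" using False by (simp add: u_def norm_vscale norm_inverse)
  have "complex_dot (c w) u = of_real (inverse (norm (c w))) * complex_dot (c w) v"
    by (simp add: complex_dot_def u_def sum_distrib_left mult_ac)
  also have "\<dots> = of_real (norm (c w))"
    using False by (simp add: v_def complex_dot_conj power2_eq_square)
  finally have dot: "complex_dot (c w) u = of_real (norm (c w))" .
  let ?q = "\<lambda>\<zeta>. f (w + \<zeta> *s u)"
  have mem: "w + \<zeta> *s u \<in> cball w r" if "norm \<zeta> \<le> r" for \<zeta>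
    using that nu by (simp add: dist_norm norm_vscale)
  have der: "(?q has_field_derivative complex_dot (c (w + \<zeta> *s u)) u) (at \<zeta>)"
    if "norm \<zeta> \<le> r" for \<zeta>
    by (rule slice_has_field_derivative[OF f[OF mem[OF that]]])
  have "norm ((deriv ^^ 1) ?q 0) \<le> fact 1 * M / r ^ 1"
  proof (rule Cauchy_inequality[OF _ _ r])
    show "?q holomorphic_on ball 0 r"
      unfolding holomorphic_on_open[OF open_ball] using der by (metis mem_ball_0 less_imp_le)
    show "continuous_on (cball 0 r) ?q"
      using der by (intro continuous_at_imp_continuous_on) (auto intro!: DERIV_isCont[OF der])
    show "norm (?q \<zeta>) \<le> M" if "norm (0 - \<zeta>) = r" for \<zeta>
      using that by (intro M mem) simp
  qed
  moreover have "deriv ?q 0 = of_real (norm (c w))"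
    using DERIV_imp_deriv[OF der[of 0]] r dot by simp
  ultimately show ?thesis by simp
qed

text \<open>The gradient of \<open>f(\<cdot> + k) - f\<close> at \<open>w\<close> is the increment of the gradient of \<open>f\<close>; the Cauchy estimate bounds
  it by the oscillation of \<open>f\<close>, which is small by uniform continuity on a compact ball.\<close>

lemma continuous_on_complex_gradient:
  fixes f :: "complex ^ 'n::finite \<Rightarrow> complex"
  assumes f: "holomorphic_ball f"
  shows "continuous_on unit_ball (complex_gradient f)"
proof (rule continuous_at_imp_continuous_on, intro ballI)
  fix w :: "complex ^ 'n" assume w: "w \<in> unit_ball"
  define r where "r = (1 - norm w) / 3"
  have r: "0 < r" "norm w + 2 * r < 1" using w by (auto simp: r_def field_simps)
  have sub: "x \<in> unit_ball" if "dist w x \<le> 2 * r" for x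
    using r that norm_triangle_ineq2[of x w] by (simp add: dist_norm norm_minus_commute)
  have "uniformly_continuous_on (cball w (2 * r)) f"
    by (intro compact_uniformly_continuous continuous_on_subset[OF holomorphic_ball_continuous_on[OF f]])
       (use sub in auto)
  then have uc: "\<exists>d>0. \<forall>x\<in>cball w (2 * r). \<forall>y\<in>cball w (2 * r). dist y x < d \<longrightarrow> dist (f y) (f x) < e"
    if "e > 0" for e using that by (simp add: uniformly_continuous_on_def)
  show "isCont (complex_gradient f) w"
    unfolding continuous_at_eps_delta
  proof (intro allI impI)
    fix e :: real assume e: "0 < e"
    obtain d where d: "d > 0" and dd: "\<And>x y. x \<in> cball w (2 * r) \<Longrightarrow> y \<in> cball w (2 * r) \<Longrightarrow>
        dist y x < d \<Longrightarrow> dist (f y) (f x) < e * r / 2"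
      using uc[of "e * r / 2"] e r by auto
    show "\<exists>d>0. \<forall>x. dist x w < d \<longrightarrow> dist (complex_gradient f x) (complex_gradient f w) < e"
    proof (intro exI[of _ "min d r"] conjI allI impI)
      fix x assume x: "dist x w < min d r"
      define k where "k = x - w"
      have k: "norm k < d" "norm k < r" using x by (auto simp: k_def dist_norm)
      have near: "y + k \<in> cball w (2 * r)" "y \<in> cball w (2 * r)" if "y \<in> cball w r" for y
        using that k r norm_triangle_ineq[of "y - w" k]
        by (auto simp: dist_norm norm_minus_commute algebra_simps)
      have "norm (complex_gradient f (w + k) - complex_gradient f w) \<le> (e * r / 2) / r"
      proof (rule norm_gradient_le[where f = "\<lambda>y. f (y + k) - f y"
            and c = "\<lambda>y. complex_gradient f (y + k) - complex_gradient f y"])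
        fix y assume y: "y \<in> cball w r"
        have 1: "(f has_derivative complex_dot (complex_gradient f (y + k))) (at (y + k))"
          and 2: "(f has_derivative complex_dot (complex_gradient f y)) (at y)"
          using near[OF y] sub by (auto intro!: holomorphic_ball_has_derivative[OF f])
        have "((\<lambda>y. f (y + k)) has_derivative complex_dot (complex_gradient f (y + k))) (at y)"
          using has_derivative_compose[of "\<lambda>y. y + k" "\<lambda>h. h", OF _ 1]
          by (simp add: has_derivative_add_const)
        from has_derivative_diff[OF this 2]
        show "((\<lambda>y. f (y + k) - f y) has_derivative
            complex_dot (complex_gradient f (y + k) - complex_gradient f y)) (at y)"
          by (simp add: bounded_bilinear.diff_left[OF bounded_bilinear_complex_dot, abs_def])
        show "norm (f (y + k) - f y) \<le> e * r / 2"
          using dd[of y "y + k"] near[OF y] k by (simp add: dist_norm)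
      qed (use r in auto)
      also have "(e * r / 2) / r < e" using e r by simp
      finally show "dist (complex_gradient f x) (complex_gradient f w) < e"
        by (simp add: k_def dist_norm)
    qed (use d r in auto)
  qed
qed

lemma has_derivative_integral_parameter:
  fixes k :: "complex ^ 'n::finite \<Rightarrow> real \<Rightarrow> complex" and c :: "complex ^ 'n \<Rightarrow> real \<Rightarrow> complex ^ 'n"
  assumes U: "open U" "convex U" and z: "z \<in> U"
    and der: "\<And>x t. x \<in> U \<Longrightarrow> t \<in> {0..1} \<Longrightarrow> ((\<lambda>x. k x t) has_derivative complex_dot (c x t)) (at x)"
    and int: "\<And>x. x \<in> U \<Longrightarrow> k x integrable_on {0..1}"
    and cont: "continuous_on (U \<times> {0..1}) (\<lambda>(x, t). c x t)"
  shows "((\<lambda>x. integral {0..1} (k x)) has_derivative complex_dot (integral {0..1} (c z))) (at z)"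
proof -
  define D where "D v = Blinfun (complex_dot v)" for v :: "complex ^ 'n"
  have D_apply: "blinfun_apply (D v) = complex_dot v" for v
    by (simp add: D_def bounded_linear_Blinfun_apply bounded_linear_complex_dot)
  have D: "bounded_linear D"
  proof (rule bounded_linear_intro)
    show "norm (D v) \<le> norm v * 1" for v
      by (rule norm_blinfun_bound) (auto simp: D_apply norm_complex_dot_le)
  qed (auto intro!: blinfun_eqI simp: D_apply plus_blinfun.rep_eq scaleR_blinfun.rep_eq
        bounded_bilinear.add_left[OF bounded_bilinear_complex_dot]
        bounded_bilinear.scaleR_left[OF bounded_bilinear_complex_dot])
  have cont_z: "continuous_on {0..1} (c z)"
    using continuous_on_compose2[OF cont, of "{0..1}" "\<lambda>t. (z, t)"] z
    by (simp add: continuous_on_Pair image_subset_iff)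
  have "((\<lambda>x. integral (cbox 0 1) (k x)) has_derivative blinfun_apply (integral (cbox 0 1) (\<lambda>t. D (c z t)))) (at z within U)"
  proof (rule leibniz_rule[OF _ _ _ z U(2)])
    show "((\<lambda>x. k x t) has_derivative blinfun_apply (D (c x t))) (at x within U)"
      if "x \<in> U" "t \<in> cbox 0 1" for x t
      using der that by (simp add: D_apply has_derivative_at_withinI)
    show "continuous_on (U \<times> cbox 0 1) (\<lambda>(x, t). D (c x t))"
      using bounded_linear.continuous_on[OF D cont] by (simp add: split_def)
  qed (use int in auto)
  also have "integral (cbox 0 1) (\<lambda>t. D (c z t)) = D (integral {0..1} (c z))"
    using integral_linear[OF integrable_continuous_interval[OF cont_z] D] by (simp add: o_def)
  finally show ?thesis by (simp add: D_apply at_within_open[OF z U(1)])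
qed

lemma scaleR_eq_vscale: "t *\<^sub>R x = of_real t *s (x::complex^'n::finite)"
  by (simp add: vec_eq_iff scaleR_conv_of_real[where 'a = complex])

text \<open>Cauchy's formula in the \<open>j\<close>-th variable, parametrised over a fixed interval.  It exhibits a partial
  derivative as an average of translates of \<open>f\<close>, which can be differentiated under the integral in all
  variables at once.\<close>

lemma complex_partial_eq_circle_mean:
  fixes f :: "complex ^ 'n::finite \<Rightarrow> complex"
  assumes f: "holomorphic_ball f" and r: "0 < r" "norm x + r < 1"
  shows "complex_partial j f x =
    integral {0..1} (\<lambda>t. exp (- (2 * of_real pi * \<i> * of_real t)) / of_real r *
        f (x + (of_real r * exp (2 * of_real pi * \<i> * of_real t)) *s axis j 1))"
    (is "_ = integral _ ?k")
proof -
  let ?Q = "\<lambda>\<zeta>. f (x + \<zeta> *s axis j 1)"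
  have der: "(?Q has_field_derivative complex_gradient f (x + \<zeta> *s axis j 1) $ j) (at \<zeta>)"
    if "norm \<zeta> \<le> r" for \<zeta>
  proof -
    have "x + \<zeta> *s axis j 1 \<in> unit_ball"
      using that r norm_triangle_ineq[of x "\<zeta> *s axis j 1"] by (simp add: norm_vscale norm_axis_1)
    from slice_has_field_derivative[OF holomorphic_ball_has_derivative[OF f this]]
    show ?thesis by simp
  qed
  have cont: "continuous_on (cball 0 r) ?Q"
    using der by (intro continuous_at_imp_continuous_on) (auto intro!: DERIV_isCont[OF der])
  have hol: "?Q holomorphic_on ball 0 r"
    unfolding holomorphic_on_open[OF open_ball] using der by (metis mem_ball_0 less_imp_le)
  have "(?Q has_field_derivative 1 / (2 * of_real pi * \<i>) *
      contour_integral (circlepath 0 r) (\<lambda>u. ?Q u / (u - 0)\<^sup>2)) (at 0)"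
    by (rule Cauchy_derivative_integral_circlepath[OF cont hol]) (use r in auto)
  from DERIV_unique[OF der[of 0] this] r have "complex_partial j f x = 1 / (2 * of_real pi * \<i>) *
      contour_integral (circlepath 0 r) (\<lambda>u. ?Q u / (u - 0)\<^sup>2)"
    by (simp add: complex_gradient_def)
  also have "contour_integral (circlepath 0 r) (\<lambda>u. ?Q u / (u - 0)\<^sup>2) =
      integral {0..1} (\<lambda>t. (2 * of_real pi * \<i>) * ?k t)"
    unfolding contour_integral_integral
    unfolding vector_derivative_circlepath
    using r by (intro integral_cong) (simp add: circlepath power2_eq_square exp_minus field_simps)
  finally show ?thesis by simp
qed

proposition holomorphic_ball_complex_partial:
  fixes f :: "complex ^ 'n::finite \<Rightarrow> complex"
  assumes f: "holomorphic_ball f"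
  shows "holomorphic_ball (complex_partial j f)"
proof -
  have "\<exists>c. (complex_partial j f has_derivative complex_dot c) (at z)" if z: "z \<in> unit_ball" for z
  proof -
    define r where "r = (1 - norm z) / 3"
    have r: "0 < r" "norm z + 2 * r < 1" using z by (auto simp: r_def field_simps)
    define e where "e t = exp (2 * of_real pi * \<i> * of_real t)" for t :: real
    define s where "s x t = x + (of_real r * e t) *s axis j 1" for x :: "complex ^ 'n" and t
    define k where "k x t = exp (- (2 * of_real pi * \<i> * of_real t)) / of_real r * f (s x t)" for x t
    define c where "c x t = (exp (- (2 * of_real pi * \<i> * of_real t)) / of_real r) *s complex_gradient f (s x t)" for x t
    have near: "norm x + r < 1" if "x \<in> ball z r" for x
      using that r norm_triangle_ineq2[of x z] by (simp add: dist_norm norm_minus_commute)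
    have s_in: "s x t \<in> unit_ball" if "x \<in> ball z r" for x t
      using near[OF that] norm_triangle_ineq[of x "(of_real r * e t) *s axis j 1"] r
      by (simp add: s_def e_def norm_vscale norm_axis_1 norm_mult)
    have s_cont: "continuous_on X (\<lambda>p. s (fst p) (snd p))" for X
      unfolding s_def e_def
      by (intro continuous_intros bounded_linear.continuous_on[OF bounded_linear_vscale])
    have s_cont1: "continuous_on X (\<lambda>t. s x t)" for X x
      unfolding s_def e_def
      by (intro continuous_intros bounded_linear.continuous_on[OF bounded_linear_vscale])
    have "((\<lambda>x. integral {0..1} (k x)) has_derivative complex_dot (integral {0..1} (c z))) (at z)"
    proof (rule has_derivative_integral_parameter[of "ball z r"])
      fix x t assume x: "x \<in> ball z r"
      have "((\<lambda>x. s x t) has_derivative (\<lambda>h. h)) (at x)"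
        unfolding s_def by (auto intro!: derivative_eq_intros)
      from has_derivative_compose[OF this holomorphic_ball_has_derivative[OF f s_in[OF x]]]
      have "((\<lambda>x. f (s x t)) has_derivative complex_dot (complex_gradient f (s x t))) (at x)" .
      then have "((\<lambda>x. k x t) has_derivative
          (\<lambda>h. exp (- (2 * of_real pi * \<i> * of_real t)) / of_real r * complex_dot (complex_gradient f (s x t)) h)) (at x)"
        unfolding k_def by (rule has_derivative_mult_right)
      then show "((\<lambda>x. k x t) has_derivative complex_dot (c x t)) (at x)"
        by (simp add: c_def complex_dot_def[abs_def] sum_distrib_left sum_divide_distrib mult_ac)
    next
      fix x assume x: "x \<in> ball z r"
      have "continuous_on {0..1} (\<lambda>t. f (s x t))"
        by (rule continuous_on_compose2[OF holomorphic_ball_continuous_on[OF f] s_cont1])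
           (use s_in[OF x] in auto)
      then have "continuous_on {0..1} (k x)"
        unfolding k_def using r by (intro continuous_intros) auto
      then show "k x integrable_on {0..1}" by (rule integrable_continuous_interval)
    next
      have g: "continuous_on (ball z r \<times> {0..1}) (\<lambda>p. complex_gradient f (s (fst p) (snd p)))"
        by (rule continuous_on_compose2[OF continuous_on_complex_gradient[OF f] s_cont]) (use s_in in auto)
      show "continuous_on (ball z r \<times> {0..1}) (\<lambda>(x, t). c x t)"
        unfolding c_def split_def vector_scalar_mult_def
        using r by (intro continuous_intros continuous_on_component g) auto
    qed (use r in auto)
    moreover have "integral {0..1} (k x) = complex_partial j f x" if "x \<in> ball z r" for x
      unfolding complex_partial_eq_circle_mean[OF f r(1) near[OF that]] k_def s_def e_def ..
    ultimately have "(complex_partial j f has_derivative complex_dot (integral {0..1} (c z))) (at z)"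
      using r by (elim has_derivative_transform_within_open[of _ _ _ _ "ball z r"]) auto
    then show ?thesis by blast
  qed
  then show ?thesis by (metis holomorphic_ballI)
qed

lemma holomorphic_ball_mult:
  fixes f g :: "complex ^ 'n::finite \<Rightarrow> complex"
  assumes "holomorphic_ball f" "holomorphic_ball g"
  shows "holomorphic_ball (\<lambda>z. f z * g z)"
proof (rule holomorphic_ballI)
  fix z :: "complex ^ 'n" assume z: "z \<in> unit_ball"
  have "((\<lambda>z. f z * g z) has_derivative
      (\<lambda>h. f z * complex_dot (complex_gradient g z) h + complex_dot (complex_gradient f z) h * g z)) (at z)"
    using assms z by (intro has_derivative_mult holomorphic_ball_has_derivative)
  then show "((\<lambda>z. f z * g z) has_derivative
      complex_dot (\<chi> j. f z * complex_gradient g z $ j + complex_gradient f z $ j * g z)) (at z)"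
    by (simp add: complex_dot_def[abs_def] sum_distrib_left sum.distrib algebra_simps)
qed

lemma holomorphic_ball_sum:
  fixes f :: "'i \<Rightarrow> complex ^ 'n::finite \<Rightarrow> complex"
  assumes "\<And>i. i \<in> I \<Longrightarrow> holomorphic_ball (f i)"
  shows "holomorphic_ball (\<lambda>z. \<Sum>i\<in>I. f i z)"
proof (rule holomorphic_ballI)
  fix z :: "complex ^ 'n" assume z: "z \<in> unit_ball"
  have "((\<lambda>z. \<Sum>i\<in>I. f i z) has_derivative (\<lambda>h. \<Sum>i\<in>I. complex_dot (complex_gradient (f i) z) h)) (at z)"
    using assms z by (intro has_derivative_sum holomorphic_ball_has_derivative)
  then show "((\<lambda>z. \<Sum>i\<in>I. f i z) has_derivative complex_dot (\<Sum>i\<in>I. complex_gradient (f i) z)) (at z)"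
    by (simp add: bounded_bilinear.sum_left[OF bounded_bilinear_complex_dot, abs_def])
qed

lemma holomorphic_ball_coordinate: "holomorphic_ball (\<lambda>z::complex ^ 'n::finite. z $ j)"
proof (rule holomorphic_ballI)
  fix z :: "complex ^ 'n"
  have "complex_dot (axis j 1) = (\<lambda>h. h $ j)"
    by (simp add: fun_eq_iff complex_dot_def axis_def if_distrib[of "\<lambda>x. x * _"] cong: if_cong)
  then show "((\<lambda>z. z $ j) has_derivative complex_dot (axis j 1)) (at z)"
    by (simp add: bounded_linear_imp_has_derivative bounded_linear_vec_nth)
qed

lemma holomorphic_ball_radial_deriv:
  "holomorphic_ball f \<Longrightarrow> holomorphic_ball (radial_deriv f)"
  unfolding radial_deriv_def
  by (intro holomorphic_ball_sum holomorphic_ball_mult holomorphic_ball_coordinate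
      holomorphic_ball_complex_partial)

lemma continuous_on_gradient_ray:
  assumes "holomorphic_ball g" "z \<in> unit_ball"
  shows "continuous_on {0..1} (\<lambda>t. complex_gradient g (t *\<^sub>R z))"
  by (rule continuous_on_compose2[OF continuous_on_complex_gradient[OF assms(1)]])
     (use assms(2) in \<open>auto intro!: continuous_intros mult_le_one le_less_trans[OF mult_left_le_one_le]\<close>)

section \<open>Inverting the radial derivative\<close>

text \<open>The integrand, continued to \<open>t = 0\<close> by its limit, has gradient \<open>(\<nabla>g)(tx)\<close> for every \<open>t\<close>: the factor \<open>t\<close>
  from the chain rule cancels the denominator.\<close>

lemma has_derivative_radial_primitive:
  fixes g :: "complex ^ 'n::finite \<Rightarrow> complex"
  assumes g: "holomorphic_ball g" and g0: "g 0 = 0" and z: "z \<in> unit_ball"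
  shows "((\<lambda>z. integral {0..1} (\<lambda>t. g (t *\<^sub>R z) / of_real t)) has_derivative
    complex_dot (integral {0..1} (\<lambda>t. complex_gradient g (t *\<^sub>R z)))) (at z)"
proof -
  define k where "k x t = (if t = 0 then complex_dot (complex_gradient g 0) x else g (t *\<^sub>R x) / of_real t)"
    for x :: "complex ^ 'n" and t :: real
  have in_ball: "t *\<^sub>R x \<in> unit_ball" if "x \<in> unit_ball" "t \<in> {0..1}" for x :: "complex ^ 'n" and t
    using that by (auto intro!: le_less_trans[OF mult_left_le_one_le])
  have "((\<lambda>x. integral {0..1} (k x)) has_derivative
      complex_dot (integral {0..1} (\<lambda>t. complex_gradient g (t *\<^sub>R z)))) (at z)"
  proof (rule has_derivative_integral_parameter[of unit_ball])
    fix x :: "complex ^ 'n" and t :: real assume x: "x \<in> unit_ball" and t: "t \<in> {0..1}"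
    show "((\<lambda>x. k x t) has_derivative complex_dot (complex_gradient g (t *\<^sub>R x))) (at x)"
    proof (cases "t = 0")
      case True
      then show ?thesis
        using bounded_linear_imp_has_derivative[OF bounded_linear_complex_dot] by (simp add: k_def)
    next
      case False
      have "((\<lambda>x. t *\<^sub>R x) has_derivative (\<lambda>h. t *\<^sub>R h)) (at x)"
        by (auto intro!: derivative_eq_intros)
      from has_derivative_compose[OF this holomorphic_ball_has_derivative[OF g in_ball[OF x t]]]
      have "((\<lambda>x. g (t *\<^sub>R x)) has_derivative (\<lambda>h. complex_dot (complex_gradient g (t *\<^sub>R x)) (t *\<^sub>R h))) (at x)" .
      then have "((\<lambda>x. g (t *\<^sub>R x) * inverse (of_real t)) has_derivative
          (\<lambda>h. complex_dot (complex_gradient g (t *\<^sub>R x)) (t *\<^sub>R h) * inverse (of_real t))) (at x)"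
        by (rule has_derivative_mult_left)
      moreover have "complex_dot c (t *\<^sub>R h) * inverse (of_real t) = complex_dot c h" for c h :: "complex ^ 'n"
        using False by (simp add: bounded_bilinear.scaleR_right[OF bounded_bilinear_complex_dot]
            scaleR_conv_of_real[where 'a = complex])
      ultimately show ?thesis using False by (simp add: k_def divide_inverse)
    qed
  next
    fix x :: "complex ^ 'n" assume x: "x \<in> unit_ball"
    let ?Q = "\<lambda>\<zeta>. g (0 + \<zeta> *s x)"
    define S where "S = {\<zeta>::complex. norm \<zeta> * norm x < 1}"
    have S: "open S" unfolding S_def by (intro open_Collect_less continuous_intros)
    have der: "(?Q has_field_derivative complex_dot (complex_gradient g (0 + \<zeta> *s x)) x) (at \<zeta>)" if "\<zeta> \<in> S" for \<zeta>
      using that by (intro slice_has_field_derivative holomorphic_ball_has_derivative[OF g])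
         (simp add: S_def norm_vscale)
    then have "?Q holomorphic_on S" using S by (auto simp: holomorphic_on_open)
    \<comment> \<open>removable singularity of the difference quotient along the slice\<close>
    from pole_lemma_open[OF this S, of 0]
    have "continuous_on S (\<lambda>\<zeta>. if \<zeta> = 0 then deriv ?Q 0 else (?Q \<zeta> - ?Q 0) / (\<zeta> - 0))"
      by (rule holomorphic_on_imp_continuous_on)
    then have "continuous_on {0..1} (\<lambda>t. (\<lambda>\<zeta>. if \<zeta> = 0 then deriv ?Q 0 else (?Q \<zeta> - ?Q 0) / (\<zeta> - 0)) (of_real t))"
      by (rule continuous_on_compose2)
         (use x in \<open>auto simp: S_def intro!: continuous_intros le_less_trans[OF mult_left_le_one_le]\<close>)
    moreover have "deriv ?Q 0 = complex_dot (complex_gradient g 0) x"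
      using DERIV_imp_deriv[OF der[of 0]] by (simp add: S_def)
    ultimately have "continuous_on {0..1} (k x)"
      by (simp add: k_def[abs_def] g0 scaleR_eq_vscale[of _ x] cong: if_cong)
    then show "k x integrable_on {0..1}" by (rule integrable_continuous_interval)
  next
    have "continuous_on (unit_ball \<times> {0..1}) (\<lambda>p. complex_gradient g (snd p *\<^sub>R fst p))"
      by (rule continuous_on_compose2[OF continuous_on_complex_gradient[OF g]])
         (use in_ball in \<open>auto intro!: continuous_intros simp del: norm_scaleR\<close>)
    then show "continuous_on (unit_ball \<times> {0..1}) (\<lambda>(x, t). complex_gradient g (t *\<^sub>R x))"
      by (simp add: split_def)
  qed (use z in auto)
  moreover have "integral {0..1} (k x) = integral {0..1} (\<lambda>t. g (t *\<^sub>R x) / of_real t)" for x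
    by (rule integral_spike[of "{0}"]) (auto simp: k_def)
  ultimately show ?thesis by simp
qed

lemma complex_dot_ray_integral_gradient:
  fixes g :: "complex ^ 'n::finite \<Rightarrow> complex"
  assumes g: "holomorphic_ball g" and z: "z \<in> unit_ball"
  shows "complex_dot (integral {0..1} (\<lambda>t. complex_gradient g (t *\<^sub>R z))) z = g z - g 0"
proof -
  have "integral {0..1} (\<lambda>t. complex_dot (complex_gradient g (t *\<^sub>R z)) z) =
      complex_dot (integral {0..1} (\<lambda>t. complex_gradient g (t *\<^sub>R z))) z"
    using integral_linear[OF integrable_continuous_interval[OF continuous_on_gradient_ray[OF g z]]
        bounded_bilinear.bounded_linear_left[OF bounded_bilinear_complex_dot]]
    by (simp add: o_def)
  moreover have "((\<lambda>t. complex_dot (complex_gradient g (t *\<^sub>R z)) z) has_integral (g (1 *\<^sub>R z) - g (0 *\<^sub>R z))) {0..1}"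
  proof (rule fundamental_theorem_of_calculus)
    fix t :: real assume t: "t \<in> {0..1}"
    have "t *\<^sub>R z \<in> unit_ball" using t z by (auto intro!: le_less_trans[OF mult_left_le_one_le])
    note d = holomorphic_ball_has_derivative[OF g this]
    have "((\<lambda>t. t *\<^sub>R z) has_derivative (\<lambda>h. h *\<^sub>R z)) (at t)"
      by (auto intro!: derivative_eq_intros)
    from has_derivative_compose[OF this d]
    show "((\<lambda>t. g (t *\<^sub>R z)) has_vector_derivative complex_dot (complex_gradient g (t *\<^sub>R z)) z) (at t within {0..1})"
      by (simp add: has_vector_derivative_def has_derivative_at_withinI
          bounded_bilinear.scaleR_right[OF bounded_bilinear_complex_dot])
  qed simp
  ultimately show ?thesis by (simp add: integral_unique)
qed


section \<open>Mean value estimates for powers of the modulus\<close>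

text \<open>The weight \<open>1 - |x|\<close>, the distance to the sphere, behaves better under dilations and translations
  than the equivalent weight \<open>1 - |x|^2\<close> of the Besov norm.\<close>

definition weighted_integral :: "real \<Rightarrow> real \<Rightarrow> (complex ^ 'n::finite \<Rightarrow> 'b::real_normed_vector) \<Rightarrow> ennreal" where
  "weighted_integral p \<alpha> u =
     (\<integral>\<^sup>+ x\<in>unit_ball. ennreal (norm (u x) powr p * (1 - norm x) powr \<alpha>) \<partial>lborel)"

lemma powr_le_powr_comparable:
  fixes a b c \<beta> :: real
  assumes "0 < a" "0 < b" "1 \<le> c" "a \<le> c * b" "b \<le> c * a"
  shows "a powr \<beta> \<le> c powr \<bar>\<beta>\<bar> * b powr \<beta>"
proof (cases "0 \<le> \<beta>")
  case True
  then have "a powr \<beta> \<le> (c * b) powr \<beta>" using assms by (intro powr_mono2) auto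
  then show ?thesis using assms True by (simp add: powr_mult)
next
  case False
  have "(c * a) powr \<beta> \<le> b powr \<beta>" using assms False by (intro powr_mono2') auto
  then have "c powr - \<beta> * (c powr \<beta> * a powr \<beta>) \<le> c powr - \<beta> * b powr \<beta>"
    using assms by (intro mult_left_mono) (auto simp: powr_mult)
  moreover have "c powr - \<beta> * (c powr \<beta> * a powr \<beta>) = a powr \<beta>"
    using assms by (simp add: powr_minus field_simps)
  ultimately show ?thesis using False by simp
qed

lemma norm_diff_le_gradient:
  fixes f :: "complex ^ 'n::finite \<Rightarrow> complex"
  assumes f: "holomorphic_ball f" and S: "convex S" "S \<subseteq> unit_ball"
    and B: "\<And>x. x \<in> S \<Longrightarrow> norm (complex_gradient f x) \<le> B" and xy: "x \<in> S" "y \<in> S"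
  shows "norm (f x - f y) \<le> B * norm (x - y)"
proof (rule differentiable_bound[OF S(1) _ _ xy])
  fix z assume z: "z \<in> S"
  show "(f has_derivative complex_dot (complex_gradient f z)) (at z within S)"
    by (rule has_derivative_at_withinI[OF holomorphic_ball_has_derivative[OF f]]) (use S z in auto)
  show "onorm (complex_dot (complex_gradient f z)) \<le> B"
    by (rule onorm_bound)
       (use B[OF z] norm_ge_zero[of "complex_gradient f z"] in
        \<open>auto intro: order_trans[OF norm_complex_dot_le] mult_right_mono order_trans[OF norm_ge_zero]\<close>)
qed

text \<open>Sub-mean-value inequality.  Maximise \<open>(r - |x - w|)^m |g x|\<close> with \<open>m = N/p\<close> over the ball.  At a
  maximiser \<open>x0\<close>, with \<open>\<rho> = r - |x0 - w|\<close>, maximality gives \<open>|g| \<le> 2^m |g x0|\<close> on the ball of radius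
  \<open>\<rho>/2\<close> around \<open>x0\<close>.  The Cauchy estimate then bounds the gradient by a multiple of \<open>|g x0|/\<rho>\<close>, so
  \<open>|g| \<ge> |g x0|/2\<close> on a ball of radius \<open>\<epsilon>\<rho>\<close>.  Integrating \<open>|g|^p\<close> over this small ball
  already yields a multiple of \<open>\<rho>^N |g x0|^p\<close>, which dominates \<open>r^N |g w|^p\<close> by the choice of \<open>x0\<close>.\<close>

proposition norm_powr_le_ball_integral:
  fixes p :: real
  assumes p: "0 < p"
  shows "\<exists>C>0. \<forall>(g :: complex ^ 'n::finite \<Rightarrow> complex) w r. holomorphic_ball g \<longrightarrow> 0 < r \<longrightarrow> norm w + r < 1 \<longrightarrow>
    ennreal (norm (g w) powr p * r ^ DIM(complex ^ 'n))
      \<le> ennreal C * (\<integral>\<^sup>+ x\<in>ball w r. ennreal (norm (g x) powr p) \<partial>lborel)"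
proof -
  define N where "N = DIM(complex ^ 'n)"
  define V where "V = unit_ball_vol N"
  have V: "0 < V" by (simp add: V_def unit_ball_vol_pos)
  have N: "0 < N" by (simp add: N_def)
  define m where "m = real N / p"
  have m: "0 < m" using p N by (simp add: m_def)
  \<comment> \<open>small enough that the gradient bound \<open>4 2^m |g x0| / \<rho>\<close> moves \<open>g\<close> by at most half of \<open>|g x0|\<close>\<close>
  define \<epsilon> where "\<epsilon> = 2 powr (- m) / 8"
  have "2 powr (- m) < 2 powr (0::real)" using m by (intro powr_less_mono) auto
  then have \<epsilon>: "0 < \<epsilon>" "\<epsilon> < 1 / 8" by (auto simp: \<epsilon>_def)
  have \<epsilon>m: "2 powr m * \<epsilon> = 1 / 8" by (simp add: \<epsilon>_def powr_minus)
  define C where "C = 2 powr p / (V * \<epsilon> ^ N)"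
  have C: "0 < C" using V \<epsilon> by (simp add: C_def)
  have "ennreal (norm (g w) powr p * r ^ N)
      \<le> ennreal C * (\<integral>\<^sup>+ x\<in>ball w r. ennreal (norm (g x) powr p) \<partial>lborel)"
    if g: "holomorphic_ball g" and r: "0 < r" "norm w + r < 1"
    for g :: "complex ^ 'n \<Rightarrow> complex" and w r
  proof (cases "g w = 0")
    case True
    then show ?thesis by simp
  next
    case False
    have inB: "cball w r \<subseteq> unit_ball"
    proof
      fix x assume "x \<in> cball w r"
      then show "x \<in> unit_ball"
        using r norm_triangle_ineq2[of x w] by (simp add: dist_norm norm_minus_commute)
    qed
    define \<psi> where "\<psi> x = (r - dist w x) powr m * norm (g x)" for x
    have "continuous_on (cball w r) \<psi>"
      unfolding \<psi>_def using m
      by (intro continuous_intros continuous_on_powr' continuous_on_subset[OF holomorphic_ball_continuous_on[OF g] inB])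
         auto
    then obtain x0 where x0: "x0 \<in> cball w r" and max: "\<And>x. x \<in> cball w r \<Longrightarrow> \<psi> x \<le> \<psi> x0"
      using continuous_attains_sup[of "cball w r" \<psi>] r by auto
    define \<rho> where "\<rho> = r - dist w x0"
    define A where "A = norm (g x0)"
    have \<psi>0: "\<psi> x0 = \<rho> powr m * A" by (simp add: \<psi>_def \<rho>_def A_def)
    have wle: "r powr m * norm (g w) \<le> \<rho> powr m * A"
      using max[of w] r \<psi>0 by (simp add: \<psi>_def)
    then have pos: "0 < \<rho> powr m * A" using False r by (auto intro: less_le_trans[rotated])
    then have \<rho>: "0 < \<rho>" using x0 by (cases "\<rho> = 0") (auto simp: \<rho>_def)
    have A: "0 < A" using pos by (cases "A = 0") (auto simp: A_def)
    have half: "norm (g x) \<le> 2 powr m * A" if x: "dist x0 x \<le> \<rho> / 2" for x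
    proof -
      have d: "\<rho> / 2 \<le> r - dist w x"
        using x dist_triangle[of w x x0] by (simp add: \<rho>_def)
      then have "(\<rho> / 2) powr m * norm (g x) \<le> \<psi> x"
        using m \<rho> unfolding \<psi>_def by (intro mult_right_mono powr_mono2) auto
      also have "\<dots> \<le> \<rho> powr m * A" using max[of x] d \<rho> \<psi>0 by simp
      finally show ?thesis using \<rho> by (simp add: powr_divide field_simps)
    qed
    have grad: "norm (complex_gradient g y) \<le> 2 powr m * A / (\<rho> / 4)" if y: "dist x0 y \<le> \<rho> / 4" for y
    proof (rule norm_gradient_le[of y "\<rho> / 4" g "complex_gradient g"])
      fix x assume "x \<in> cball y (\<rho> / 4)"
      then have x: "dist x0 x \<le> \<rho> / 2"
        using y dist_triangle[of x0 x y] by simp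
      then show "norm (g x) \<le> 2 powr m * A" by (rule half)
      have "dist w x \<le> r" using x \<rho> dist_triangle[of w x x0] by (simp add: \<rho>_def)
      then show "(g has_derivative complex_dot (complex_gradient g x)) (at x)"
        using inB by (intro holomorphic_ball_has_derivative[OF g]) auto
    qed (use \<rho> in auto)
    have sub: "dist w x < r" if "x \<in> ball x0 (\<epsilon> * \<rho>)" for x
    proof -
      have "\<epsilon> * \<rho> \<le> 1 * \<rho>" using \<epsilon> \<rho> by (intro mult_right_mono) auto
      then show ?thesis using that dist_triangle[of w x x0] by (simp add: \<rho>_def)
    qed
    have lower: "A / 2 \<le> norm (g x)" if x: "x \<in> ball x0 (\<epsilon> * \<rho>)" for x
    proof -
      have "\<epsilon> * \<rho> \<le> 1 / 4 * \<rho>" using \<epsilon> \<rho> by (intro mult_right_mono) auto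
      then have "dist x0 y \<le> \<rho> / 4" if "y \<in> ball x0 (\<epsilon> * \<rho>)" for y
        using that by simp
      then have "norm (g x - g x0) \<le> 2 powr m * A / (\<rho> / 4) * norm (x - x0)"
        using x \<epsilon> \<rho> sub inB
        by (intro norm_diff_le_gradient[OF g convex_ball[of x0 "\<epsilon> * \<rho>"]] grad) (auto simp: less_imp_le)
      also have "\<dots> \<le> 2 powr m * A / (\<rho> / 4) * (\<epsilon> * \<rho>)"
        using x A \<rho> by (intro mult_left_mono) (auto simp: dist_norm norm_minus_commute)
      also have "\<dots> = 4 * A * (2 powr m * \<epsilon>)" using \<rho> by (simp add: field_simps)
      also have "\<dots> = A / 2" by (simp add: \<epsilon>m)
      finally show ?thesis
        using norm_triangle_ineq2[of "g x0" "g x"] by (simp add: A_def norm_minus_commute)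
    qed
    have "norm (g w) powr p * r ^ N = (r powr m * norm (g w)) powr p"
      using r p by (simp add: powr_mult powr_powr m_def powr_realpow)
    also have "\<dots> \<le> (\<rho> powr m * A) powr p" using wle p by (intro powr_mono2) auto
    also have "\<dots> = \<rho> ^ N * A powr p"
      using \<rho> p A by (simp add: powr_mult powr_powr m_def powr_realpow)
    also have "\<dots> = C * ((A / 2) powr p * (V * (\<epsilon> * \<rho>) ^ N))"
      using V \<epsilon> A by (simp add: C_def powr_divide power_mult_distrib)
    finally have "ennreal (norm (g w) powr p * r ^ N) \<le> ennreal C * ennreal ((A / 2) powr p * (V * (\<epsilon> * \<rho>) ^ N))"
      using C A V \<epsilon> \<rho> by (simp add: ennreal_mult[symmetric] ennreal_leI)
    also have "ennreal ((A / 2) powr p * (V * (\<epsilon> * \<rho>) ^ N)) =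
        (\<integral>\<^sup>+ x. ennreal ((A / 2) powr p) * indicator (ball x0 (\<epsilon> * \<rho>)) x \<partial>lborel)"
      using V \<epsilon> \<rho> by (simp add: nn_integral_cmult_indicator emeasure_ball N_def V_def ennreal_mult)
    also have "\<dots> \<le> (\<integral>\<^sup>+ x\<in>ball w r. ennreal (norm (g x) powr p) \<partial>lborel)"
    proof (rule nn_integral_mono)
      fix x
      show "ennreal ((A / 2) powr p) * indicator (ball x0 (\<epsilon> * \<rho>)) x
          \<le> ennreal (norm (g x) powr p) * indicator (ball w r) x"
        using sub[of x] lower[of x] A p by (auto simp: indicator_def intro!: ennreal_leI powr_mono2)
    qed
    finally show ?thesis by (simp add: mult_left_mono)
  qed
  then show ?thesis using C unfolding N_def by blast
qed

proposition gradient_powr_le_ball_integral: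
  fixes p :: real
  assumes p: "0 < p"
  shows "\<exists>C>0. \<forall>(g :: complex ^ 'n::finite \<Rightarrow> complex) w r. holomorphic_ball g \<longrightarrow> 0 < r \<longrightarrow> norm w + r < 1 \<longrightarrow>
    ennreal (norm (complex_gradient g w) powr p * (r ^ DIM(complex ^ 'n) * r powr p))
      \<le> ennreal C * (\<integral>\<^sup>+ x\<in>ball w r. ennreal (norm (g x) powr p) \<partial>lborel)"
proof -
  define N where "N = DIM(complex ^ 'n)"
  obtain C where C: "0 < C" and mv: "\<And>(g :: complex ^ 'n \<Rightarrow> complex) w r. holomorphic_ball g \<Longrightarrow> 0 < r \<Longrightarrow> norm w + r < 1 \<Longrightarrow>
    ennreal (norm (g w) powr p * r ^ N)
      \<le> ennreal C * (\<integral>\<^sup>+ x\<in>ball w r. ennreal (norm (g x) powr p) \<partial>lborel)"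
    using norm_powr_le_ball_integral[OF p, where 'n = 'n] unfolding N_def by blast
  define C' where "C' = C * 2 ^ N * 2 powr p"
  have C': "0 < C'" using C by (simp add: C'_def)
  have "ennreal (norm (complex_gradient g w) powr p * (r ^ N * r powr p))
      \<le> ennreal C' * (\<integral>\<^sup>+ x\<in>ball w r. ennreal (norm (g x) powr p) \<partial>lborel)"
    if g: "holomorphic_ball g" and r: "0 < r" "norm w + r < 1"
    for g :: "complex ^ 'n \<Rightarrow> complex" and w r
  proof -
    define J where "J = (\<integral>\<^sup>+ x\<in>ball w r. ennreal (norm (g x) powr p) \<partial>lborel)"
    show ?thesis unfolding J_def[symmetric]
    proof (cases J)
      case top
      then show "ennreal (norm (complex_gradient g w) powr p * (r ^ N * r powr p)) \<le> ennreal C' * J"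
        using C' by (simp add: ennreal_mult_top)
    next
      case (real j)
      define M where "M = (C * j / (r / 2) ^ N) powr (1 / p)"
      have "norm (complex_gradient g w) \<le> M / (r / 2)"
      proof (rule norm_gradient_le[of w "r / 2" g "complex_gradient g"])
        fix x assume x: "x \<in> cball w (r / 2)"
        have nx: "norm x + r / 2 < 1"
          using x r norm_triangle_ineq2[of x w] by (simp add: dist_norm norm_minus_commute)
        then show "(g has_derivative complex_dot (complex_gradient g x)) (at x)"
          using r by (intro holomorphic_ball_has_derivative[OF g]) auto
        have "ennreal (norm (g x) powr p * (r / 2) ^ N)
            \<le> ennreal C * (\<integral>\<^sup>+ y\<in>ball x (r / 2). ennreal (norm (g y) powr p) \<partial>lborel)"
          by (rule mv[OF g]) (use r nx in auto)
        also have "\<dots> \<le> ennreal C * J"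
        proof -
          have "ball x (r / 2) \<subseteq> ball w r"
          proof
            fix y assume "y \<in> ball x (r / 2)"
            then show "y \<in> ball w r" using x dist_triangle[of w y x] by simp
          qed
          then show ?thesis unfolding J_def
            by (intro mult_left_mono nn_integral_mono) (auto simp: indicator_def)
        qed
        also have "\<dots> = ennreal (C * j)" using real C by (simp add: ennreal_mult)
        finally have "norm (g x) powr p * (r / 2) ^ N \<le> C * j" using C real by simp
        then have "norm (g x) powr p \<le> C * j / (r / 2) ^ N" using r by (simp add: field_simps)
        then have "(norm (g x) powr p) powr (1 / p) \<le> M"
          unfolding M_def using p by (intro powr_mono2) auto
        then show "norm (g x) \<le> M" using p by (simp add: powr_powr)
      qed (use r in auto)
      then have "norm (complex_gradient g w) powr p \<le> (M / (r / 2)) powr p"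
        using p by (intro powr_mono2) auto
      also have "\<dots> = C * j / (r / 2) ^ N / (r / 2) powr p"
        using r C real p by (simp add: M_def powr_divide powr_powr powr_mult)
      also have "\<dots> = C' * j / (r ^ N * r powr p)"
        using r by (simp add: C'_def powr_divide power_divide field_simps)
      finally have "norm (complex_gradient g w) powr p * (r ^ N * r powr p) \<le> C' * j"
        using r by (simp add: field_simps)
      then show "ennreal (norm (complex_gradient g w) powr p * (r ^ N * r powr p)) \<le> ennreal C' * J"
        using real C' by (simp add: ennreal_mult[symmetric] ennreal_leI)
    qed
  qed
  then show ?thesis using C' unfolding N_def by blast
qed

section \<open>Weighted integrals of the gradient\<close>

lemma borel_measurable_indicator_ball:
  fixes f :: "'a::euclidean_space \<Rightarrow> 'b::real_normed_vector"
  assumes "continuous_on (ball 0 1) f"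
  shows "(\<lambda>x. indicator (ball 0 1) x *\<^sub>R f x) \<in> borel_measurable borel"
  using assms by (intro borel_measurable_continuous_on_indicator) auto

lemma weighted_integral_indicator:
  "weighted_integral p \<alpha> u =
     (\<integral>\<^sup>+ x. ennreal (norm (indicator unit_ball x *\<^sub>R u x) powr p * (1 - norm x) powr \<alpha>) \<partial>lborel)"
  unfolding weighted_integral_def by (intro nn_integral_cong) (simp add: indicator_def)

text \<open>For \<open>|w| \<le> 1/2\<close> the ball of radius \<open>1/4\<close> around \<open>w\<close> stays away from the sphere, so the weight is
  bounded below on it whatever the sign of \<open>\<alpha>\<close>.\<close>

lemma gradient_le_weighted_integral:
  fixes p \<alpha> :: real
  assumes p: "0 < p"
  shows "\<exists>C>0. \<forall>(g :: complex ^ 'n::finite \<Rightarrow> complex) w. holomorphic_ball g \<longrightarrow> norm w \<le> 1 / 2 \<longrightarrow>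
    ennreal (norm (complex_gradient g w) powr p) \<le> ennreal C * weighted_integral p \<alpha> g"
proof -
  define N where "N = DIM(complex ^ 'n)"
  obtain C where C: "0 < C" and mv: "\<And>(g :: complex ^ 'n \<Rightarrow> complex) w r. holomorphic_ball g \<Longrightarrow> 0 < r \<Longrightarrow> norm w + r < 1 \<Longrightarrow>
    ennreal (norm (complex_gradient g w) powr p * (r ^ N * r powr p))
      \<le> ennreal C * (\<integral>\<^sup>+ x\<in>ball w r. ennreal (norm (g x) powr p) \<partial>lborel)"
    using gradient_powr_le_ball_integral[OF p, where 'n = 'n] unfolding N_def by blast
  define K :: real where "K = (1 / 4) ^ N * (1 / 4) powr p"
  have K: "0 < K" by (simp add: K_def)
  define D :: real where "D = 4 powr \<bar>\<alpha>\<bar>"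
  have "ennreal (norm (complex_gradient g w) powr p) \<le> ennreal (C * D / K) * weighted_integral p \<alpha> g"
    if g: "holomorphic_ball g" and w: "norm w \<le> 1 / 2" for g :: "complex ^ 'n \<Rightarrow> complex" and w
  proof -
    have "ennreal (norm (complex_gradient g w) powr p) * ennreal K = ennreal (norm (complex_gradient g w) powr p * K)"
      using K by (simp add: ennreal_mult)
    also have "\<dots> \<le> ennreal C * (\<integral>\<^sup>+ x\<in>ball w (1 / 4). ennreal (norm (g x) powr p) \<partial>lborel)"
      unfolding K_def by (rule mv[OF g]) (use w in auto)
    also have "\<dots> \<le> ennreal C *
        (\<integral>\<^sup>+ x. ennreal D * (ennreal (norm (g x) powr p * (1 - norm x) powr \<alpha>) * indicator unit_ball x) \<partial>lborel)"
    proof (intro mult_left_mono nn_integral_mono)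
      fix x
      show "ennreal (norm (g x) powr p) * indicator (ball w (1 / 4)) x
          \<le> ennreal D * (ennreal (norm (g x) powr p * (1 - norm x) powr \<alpha>) * indicator unit_ball x)"
      proof (cases "x \<in> ball w (1 / 4)")
        case True
        then have x: "norm x \<le> 3 / 4"
          using w norm_triangle_ineq2[of x w] by (simp add: dist_norm norm_minus_commute)
        have "1 powr \<alpha> \<le> 4 powr \<bar>\<alpha>\<bar> * (1 - norm x) powr \<alpha>"
        proof (rule powr_le_powr_comparable)
          show "1 - norm x \<le> 4 * 1" using norm_ge_zero[of x] by linarith
        qed (use x in auto)
        then have "norm (g x) powr p * 1 \<le> norm (g x) powr p * (D * (1 - norm x) powr \<alpha>)"
          unfolding D_def by (intro mult_left_mono) auto
        then have "norm (g x) powr p \<le> D * (norm (g x) powr p * (1 - norm x) powr \<alpha>)"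
          by (simp add: mult_ac)
        then show ?thesis using x True by (simp add: D_def ennreal_mult[symmetric] ennreal_leI)
      qed simp
    qed simp
    also have "(\<integral>\<^sup>+ x. ennreal D * (ennreal (norm (g x) powr p * (1 - norm x) powr \<alpha>) * indicator unit_ball x) \<partial>lborel)
        = ennreal D * weighted_integral p \<alpha> g"
    proof -
      define G where "G x = indicator unit_ball x *\<^sub>R g x" for x
      have [measurable]: "G \<in> borel_measurable borel"
        unfolding G_def by (rule borel_measurable_indicator_ball[OF holomorphic_ball_continuous_on[OF g]])
      have "(\<lambda>x. ennreal (norm (g x) powr p * (1 - norm x) powr \<alpha>) * indicator unit_ball x) =
          (\<lambda>x. ennreal (norm (G x) powr p * (1 - norm x) powr \<alpha>))"
        by (rule ext) (simp add: G_def indicator_def)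
      also have "\<dots> \<in> borel_measurable lborel" by measurable
      finally show ?thesis unfolding weighted_integral_def by (rule nn_integral_cmult)
    qed
    finally have "ennreal (norm (complex_gradient g w) powr p) * ennreal K * ennreal (1 / K)
        \<le> ennreal C * (ennreal D * weighted_integral p \<alpha> g) * ennreal (1 / K)"
      by (intro mult_right_mono) simp_all
    moreover have "ennreal a * ennreal K * ennreal (1 / K) = ennreal a" if "0 \<le> a" for a
      using K that by (simp add: ennreal_mult[symmetric])
    moreover have "ennreal C * (ennreal D * I) * ennreal (1 / K) = ennreal (C * D / K) * I" for I
    proof -
      have "ennreal (C * D / K) = ennreal C * ennreal D * ennreal (1 / K)"
        using C K by (simp add: D_def ennreal_mult[symmetric])
      then show ?thesis by (simp add: mult_ac)
    qed
    ultimately show ?thesis by simp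
  qed
  moreover have "0 < C * D / K" using C K by (simp add: D_def)
  ultimately show ?thesis by blast
qed

text \<open>The mean value estimate at \<open>w\<close> is used with radius half the distance \<open>d\<close> of \<open>w\<close> to the sphere.  All
  points \<open>x\<close> of that ball have \<open>1 - |x|\<close> comparable to \<open>d\<close>, so the weight can be moved from \<open>w\<close> to \<open>x\<close>;
  after exchanging the integrals, the points \<open>w\<close> belonging to a given \<open>x\<close> lie in the ball around \<open>x\<close> of
  radius \<open>1 - |x|\<close>, whose volume cancels the power \<open>d^N\<close> lost before.\<close>

proposition gradient_weighted_integral_le:
  fixes p \<alpha> :: real
  assumes p: "0 < p"
  shows "\<exists>C>0. \<forall>g :: complex ^ 'n::finite \<Rightarrow> complex. holomorphic_ball g \<longrightarrow>
    weighted_integral p (\<alpha> + p) (complex_gradient g) \<le> ennreal C * weighted_integral p \<alpha> g"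
proof -
  define N where "N = DIM(complex ^ 'n)"
  define V where "V = unit_ball_vol N"
  have V: "0 < V" by (simp add: V_def unit_ball_vol_pos)
  obtain C where C: "0 < C" and mv: "\<And>(g :: complex ^ 'n \<Rightarrow> complex) w r. holomorphic_ball g \<Longrightarrow> 0 < r \<Longrightarrow> norm w + r < 1 \<Longrightarrow>
    ennreal (norm (complex_gradient g w) powr p * (r ^ N * r powr p))
      \<le> ennreal C * (\<integral>\<^sup>+ x\<in>ball w r. ennreal (norm (g x) powr p) \<partial>lborel)"
    using gradient_powr_le_ball_integral[OF p, where 'n = 'n] unfolding N_def by blast
  define \<beta> where "\<beta> = \<alpha> - real N"
  define K where "K = C * 2 ^ N * 2 powr p * 2 powr \<bar>\<beta>\<bar>"
  have K: "0 < K" using C by (simp add: K_def)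
  have "weighted_integral p (\<alpha> + p) (complex_gradient g) \<le> ennreal (K * V) * weighted_integral p \<alpha> g"
    if g: "holomorphic_ball g" for g :: "complex ^ 'n \<Rightarrow> complex"
  proof -
    define G where "G x = indicator unit_ball x *\<^sub>R g x" for x
    have G[measurable]: "G \<in> borel_measurable borel"
      unfolding G_def by (rule borel_measurable_indicator_ball[OF holomorphic_ball_continuous_on[OF g]])
    define h where "h x = norm (G x) powr p * (1 - norm x) powr \<beta>" for x
    have h[measurable]: "h \<in> borel_measurable borel" unfolding h_def by measurable
    have pointwise: "ennreal (norm (complex_gradient g w) powr p * (1 - norm w) powr (\<alpha> + p)) * indicator unit_ball w
        \<le> (\<integral>\<^sup>+ x. ennreal K * (ennreal (h x) * indicator (ball x (1 - norm x)) w) \<partial>lborel)" for w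
    proof (cases "w \<in> unit_ball")
      case True
      define d where "d = 1 - norm w"
      have d: "0 < d" using True by (simp add: d_def)
      have "ennreal (norm (complex_gradient g w) powr p * ((d / 2) ^ N * (d / 2) powr p))
          \<le> ennreal C * (\<integral>\<^sup>+ x\<in>ball w (d / 2). ennreal (norm (g x) powr p) \<partial>lborel)"
        by (rule mv[OF g]) (use d in \<open>auto simp: d_def field_simps\<close>)
      then have "ennreal (2 ^ N * 2 powr p * d powr \<beta>) *
            ennreal (norm (complex_gradient g w) powr p * ((d / 2) ^ N * (d / 2) powr p))
          \<le> ennreal (2 ^ N * 2 powr p * d powr \<beta>) *
            (ennreal C * (\<integral>\<^sup>+ x\<in>ball w (d / 2). ennreal (norm (g x) powr p) \<partial>lborel))"
        by (rule mult_left_mono) simp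
      also have "ennreal (2 ^ N * 2 powr p * d powr \<beta>) *
            ennreal (norm (complex_gradient g w) powr p * ((d / 2) ^ N * (d / 2) powr p))
          = ennreal (norm (complex_gradient g w) powr p * d powr (\<alpha> + p))"
      proof -
        have "d powr (\<alpha> + p) = d powr \<beta> * d ^ N * d powr p"
          using d by (simp add: \<beta>_def powr_add[symmetric] powr_realpow[symmetric])
        then show ?thesis
          using d by (simp add: ennreal_mult[symmetric] powr_divide power_divide mult_ac)
      qed
      also have "ennreal (2 ^ N * 2 powr p * d powr \<beta>) *
            (ennreal C * (\<integral>\<^sup>+ x\<in>ball w (d / 2). ennreal (norm (g x) powr p) \<partial>lborel))
          = (\<integral>\<^sup>+ x. ennreal (C * 2 ^ N * 2 powr p * d powr \<beta>) *
               (ennreal (norm (g x) powr p) * indicator (ball w (d / 2)) x) \<partial>lborel)"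
      proof -
        have sub: "ball w (d / 2) \<subseteq> unit_ball"
        proof
          fix x assume "x \<in> ball w (d / 2)"
          then show "x \<in> unit_ball"
            using d norm_triangle_ineq2[of x w] by (simp add: d_def dist_norm norm_minus_commute)
        qed
        have "(\<lambda>x. ennreal (norm (G x) powr p) * indicator (ball w (d / 2)) x) \<in> borel_measurable lborel"
          by (intro borel_measurable_times_ennreal borel_measurable_indicator) auto
        also have "(\<lambda>x. ennreal (norm (G x) powr p) * indicator (ball w (d / 2)) x) =
            (\<lambda>x. ennreal (norm (g x) powr p) * indicator (ball w (d / 2)) x)"
        proof
          fix x
          show "ennreal (norm (G x) powr p) * indicator (ball w (d / 2)) x =
              ennreal (norm (g x) powr p) * indicator (ball w (d / 2)) x"
            by (cases "x \<in> ball w (d / 2)") (use sub in \<open>auto simp: G_def indicator_def\<close>)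
        qed
        finally show ?thesis
          using C d by (simp add: nn_integral_cmult ennreal_mult mult_ac)
      qed
      also have "\<dots> \<le> (\<integral>\<^sup>+ x. ennreal K * (ennreal (h x) * indicator (ball x (1 - norm x)) w) \<partial>lborel)"
      proof (rule nn_integral_mono)
        fix x
        show "ennreal (C * 2 ^ N * 2 powr p * d powr \<beta>) * (ennreal (norm (g x) powr p) * indicator (ball w (d / 2)) x)
            \<le> ennreal K * (ennreal (h x) * indicator (ball x (1 - norm x)) w)"
        proof (cases "x \<in> ball w (d / 2)")
          case True
          then have x: "dist x w < d / 2" by (simp add: dist_commute)
          have dx: "d / 2 \<le> 1 - norm x" "1 - norm x \<le> 2 * d"
            using x d norm_triangle_ineq3[of x w] by (auto simp: d_def dist_norm)
          have "d powr \<beta> \<le> 2 powr \<bar>\<beta>\<bar> * (1 - norm x) powr \<beta>"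
            by (rule powr_le_powr_comparable) (use d dx in auto)
          then have "C * 2 ^ N * 2 powr p * norm (g x) powr p * d powr \<beta>
              \<le> C * 2 ^ N * 2 powr p * norm (g x) powr p * (2 powr \<bar>\<beta>\<bar> * (1 - norm x) powr \<beta>)"
            using C by (intro mult_left_mono) auto
          also have "\<dots> = K * h x" using dx d by (simp add: K_def h_def G_def mult_ac)
          finally show ?thesis using C K x dx True
            by (simp add: ennreal_mult[symmetric] h_def ennreal_leI mult_ac)
        qed simp
      qed
      finally show ?thesis using True by (simp add: d_def)
    qed simp
    have "weighted_integral p (\<alpha> + p) (complex_gradient g)
        \<le> (\<integral>\<^sup>+ w. \<integral>\<^sup>+ x. ennreal K * (ennreal (h x) * indicator (ball x (1 - norm x)) w) \<partial>lborel \<partial>lborel)"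
      unfolding weighted_integral_def by (rule nn_integral_mono[OF pointwise])
    also have "\<dots> = (\<integral>\<^sup>+ x. \<integral>\<^sup>+ w. ennreal K * (ennreal (h x) * indicator (ball x (1 - norm x)) w) \<partial>lborel \<partial>lborel)"
    proof (rule lborel_pair.Fubini')
      have "(\<lambda>(x, w). ennreal K * (ennreal (h x) * (if dist x w < 1 - norm x then 1 else 0)))
          \<in> borel_measurable (lborel \<Otimes>\<^sub>M lborel)"
        by measurable
      then show "(\<lambda>(x, w). ennreal K * (ennreal (h x) * indicator (ball x (1 - norm x)) w))
          \<in> borel_measurable (lborel \<Otimes>\<^sub>M lborel)"
        by (simp add: indicator_def)
    qed
    also have "\<dots> = (\<integral>\<^sup>+ x. ennreal (K * V) * ennreal (norm (G x) powr p * (1 - norm x) powr \<alpha>) \<partial>lborel)"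
    proof (rule nn_integral_cong)
      fix x :: "complex ^ 'n"
      show "(\<integral>\<^sup>+ w. ennreal K * (ennreal (h x) * indicator (ball x (1 - norm x)) w) \<partial>lborel)
          = ennreal (K * V) * ennreal (norm (G x) powr p * (1 - norm x) powr \<alpha>)"
      proof (cases "x \<in> unit_ball")
        case True
        then have d: "0 < 1 - norm x" by simp
        then have \<alpha>: "(1 - norm x) powr \<alpha> = (1 - norm x) powr \<beta> * (1 - norm x) ^ N"
          by (simp add: \<beta>_def powr_add[symmetric] powr_realpow[symmetric])
        have "(\<integral>\<^sup>+ w. ennreal K * (ennreal (h x) * indicator (ball x (1 - norm x)) w) \<partial>lborel)
            = (ennreal K * ennreal (h x)) * emeasure lborel (ball x (1 - norm x))"
          by (simp only: mult.assoc[symmetric]) (rule nn_integral_cmult_indicator, simp)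
        also have "emeasure lborel (ball x (1 - norm x)) = ennreal (V * (1 - norm x) ^ N)"
          using d by (simp add: emeasure_ball V_def N_def)
        also have "(ennreal K * ennreal (h x)) * ennreal (V * (1 - norm x) ^ N)
            = ennreal ((K * h x) * (V * (1 - norm x) ^ N))"
          using d K V by (simp only: ennreal_mult[symmetric] h_def) (simp add: ennreal_mult[symmetric])
        also have "(K * h x) * (V * (1 - norm x) ^ N) = (K * V) * (norm (G x) powr p * (1 - norm x) powr \<alpha>)"
          by (simp only: h_def \<alpha> mult_ac)
        also have "ennreal \<dots> = ennreal (K * V) * ennreal (norm (G x) powr p * (1 - norm x) powr \<alpha>)"
          using K V by (intro ennreal_mult) auto
        finally show ?thesis .
      next
        case False
        then show ?thesis by (simp add: h_def G_def)
      qed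
    qed
    also have "\<dots> = ennreal (K * V) * weighted_integral p \<alpha> g"
      unfolding weighted_integral_indicator G_def[symmetric] by (rule nn_integral_cmult) measurable
    finally show ?thesis .
  qed
  moreover have "0 < K * V" using K V by simp
  ultimately show ?thesis by blast
qed


section \<open>A weighted Hardy inequality along rays\<close>

lemma powr_tangent_le:
  fixes a x p :: real
  assumes "1 < p" "0 \<le> a" "0 \<le> x"
  shows "p * a powr (p - 1) * x \<le> x powr p + (p - 1) * a powr p"
proof -
  have "x * a powr (p - 1) \<le> x powr p / p + (a powr (p - 1)) powr (p / (p - 1)) / (p / (p - 1))"
    using assms by (intro Youngs_inequality) (auto simp: field_simps)
  also have "(a powr (p - 1)) powr (p / (p - 1)) = a powr p"
    using assms by (simp add: powr_powr)
  finally show ?thesis using assms by (simp add: field_simps)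
qed

text \<open>Hoelder's inequality in the form needed for Hardy's inequality, with an upper bound \<open>K\<close> of the dual
  weight integral.  It is Jensen's inequality for the measure \<open>w^(-1/(p-1)) dt\<close>: integrate the tangent
  line bound of \<open>x^p\<close> at the mean value \<open>A = I/K\<close>.\<close>

lemma weighted_Holder_interval:
  fixes u w :: "real \<Rightarrow> real" and a b p :: real
  assumes p: "1 < p" and u: "continuous_on {a..b} u" "\<And>t. t \<in> {a..b} \<Longrightarrow> 0 \<le> u t"
    and w: "continuous_on {a..b} w" "\<And>t. t \<in> {a..b} \<Longrightarrow> 0 < w t"
    and K: "integral {a..b} (\<lambda>t. w t powr (- 1 / (p - 1))) \<le> K" "0 < K"
  shows "(integral {a..b} u) powr p \<le> K powr (p - 1) * integral {a..b} (\<lambda>t. u t powr p * w t)"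
proof -
  define I where "I = integral {a..b} u"
  define J where "J = integral {a..b} (\<lambda>t. u t powr p * w t)"
  define v where "v t = w t powr (- 1 / (p - 1))" for t
  define A where "A = I / K"
  have w0: "w t \<noteq> 0" if "t \<in> {a..b}" for t using w(2)[OF that] by simp
  have cJ: "continuous_on {a..b} (\<lambda>t. u t powr p * w t)"
    using p u by (intro continuous_intros continuous_on_powr' w) auto
  have cv: "continuous_on {a..b} v"
    unfolding v_def using w0 by (intro continuous_intros w) auto
  have I: "0 \<le> I" unfolding I_def by (rule integral_nonneg) (use u in \<open>auto intro: integrable_continuous_interval\<close>)
  then have A: "0 \<le> A" using K by (simp add: A_def)
  have "integral {a..b} (\<lambda>t. p * A powr (p - 1) * u t)
      \<le> integral {a..b} (\<lambda>t. u t powr p * w t + (p - 1) * A powr p * v t)"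
  proof (rule integral_le)
    fix t assume t: "t \<in> {a..b}"
    define x where "x = u t * w t powr (1 / (p - 1))"
    have x: "0 \<le> x" using u(2)[OF t] by (simp add: x_def)
    have xv: "x * v t = u t" using w(2)[OF t] by (simp add: x_def v_def powr_add[symmetric] flip: minus_divide_left)
    have "p / (p - 1) - 1 / (p - 1) = 1" using p by (simp add: diff_divide_distrib[symmetric])
    then have "w t powr (p / (p - 1)) * w t powr (- 1 / (p - 1)) = w t"
      using w(2)[OF t] by (simp add: powr_add[symmetric])
    then have xpv: "x powr p * v t = u t powr p * w t"
      using w(2)[OF t] u(2)[OF t] by (simp add: x_def v_def powr_mult powr_powr mult.assoc)
    have "p * A powr (p - 1) * x * v t \<le> (x powr p + (p - 1) * A powr p) * v t"
      using powr_tangent_le[OF p A x] by (rule mult_right_mono) (simp add: v_def)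
    then show "p * A powr (p - 1) * u t \<le> u t powr p * w t + (p - 1) * A powr p * v t"
      by (simp add: distrib_right xpv mult.assoc xv)
  qed (intro integrable_continuous_interval continuous_intros cJ cv u)+
  then have "p * A powr (p - 1) * I \<le> J + (p - 1) * A powr p * integral {a..b} v"
    using cJ cv by (simp add: I_def J_def integral_add integrable_continuous_interval continuous_intros)
  also have "\<dots> \<le> J + (p - 1) * A powr p * K"
    using K p by (intro add_left_mono mult_left_mono) (auto simp: v_def[abs_def])
  finally have main: "p * A powr (p - 1) * I \<le> J + (p - 1) * A powr p * K" .
  have IAK: "I = A * K" using K by (simp add: A_def)
  have AA: "A powr (p - 1) * A = A powr p"
    using A powr_mult_base[of A "p - 1"] by (simp add: mult.commute)
  have "p * A powr (p - 1) * I = p * (A powr (p - 1) * A) * K" by (simp only: IAK mult_ac)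
  then have AJ: "A powr p * K \<le> J" using main by (simp only: AA left_diff_distrib)
  have "I powr p = K powr (p - 1) * (A powr p * K)"
  proof -
    have "K powr p = K powr (p - 1) * K"
      using K powr_mult_base[of K "p - 1"] by (simp add: mult.commute)
    then show ?thesis using A K IAK by (simp add: powr_mult)
  qed
  also have "\<dots> \<le> K powr (p - 1) * J" using AJ by (intro mult_left_mono) auto
  finally show ?thesis by (simp add: I_def J_def)
qed

lemma nn_integral_lborel_scaleR:
  fixes f :: "'a::euclidean_space \<Rightarrow> ennreal"
  assumes [measurable]: "f \<in> borel_measurable borel" and c: "c \<noteq> 0"
  shows "(\<integral>\<^sup>+ x. f x \<partial>lborel) = ennreal (\<bar>c\<bar> ^ DIM('a)) * (\<integral>\<^sup>+ x. f (c *\<^sub>R x) \<partial>lborel)"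
  by (subst lborel_affine[OF c, of 0])
     (simp add: nn_integral_density nn_integral_distr nn_integral_cmult)

lemma nn_integral_powr_shift:
  fixes c \<gamma> :: real
  assumes c: "c \<le> 1" and \<gamma>: "0 < \<gamma>"
  shows "(\<integral>\<^sup>+ t. ennreal ((t - c) powr (\<gamma> - 1)) * indicator {c..1} t \<partial>lborel) = ennreal ((1 - c) powr \<gamma> / \<gamma>)"
proof -
  have "(\<integral>\<^sup>+ t. ennreal ((t - c) powr (\<gamma> - 1)) * indicator {c..1} t \<partial>lborel)
      = (\<integral>\<^sup>+ t. ennreal ((c + 1 * t - c) powr (\<gamma> - 1)) * indicator {c..1} (c + 1 * t) \<partial>lborel)"
    by (subst nn_integral_real_affine[where c = 1 and t = c]) auto
  also have "\<dots> = (\<integral>\<^sup>+ t. ennreal (t powr (\<gamma> - 1) * indicator {0..1 - c} t) \<partial>lborel)"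
    by (intro nn_integral_cong) (auto simp: indicator_def)
  also have "\<dots> = ennreal ((1 - c) powr \<gamma> / \<gamma>)"
  proof (rule nn_integral_has_integral_lborel)
    have "((\<lambda>t. t powr (\<gamma> - 1)) has_integral ((1 - c) powr \<gamma> / \<gamma>)) {0..1 - c}"
      using has_integral_powr_from_0[of "\<gamma> - 1" "1 - c"] c \<gamma> by simp
    then have "((\<lambda>t. if t \<in> {0..1 - c} then t powr (\<gamma> - 1) else 0) has_integral ((1 - c) powr \<gamma> / \<gamma>)) UNIV"
      by (simp only: has_integral_restrict_UNIV)
    then show "((\<lambda>t. t powr (\<gamma> - 1) * indicator {0..1 - c} t) has_integral ((1 - c) powr \<gamma> / \<gamma>)) UNIV"
      by (rule has_integral_eq[rotated]) (auto simp: indicator_def)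
  qed auto
  finally show ?thesis .
qed

lemma nn_integral_continuous_interval:
  fixes f :: "real \<Rightarrow> real"
  assumes f: "continuous_on {a..b} f" and nonneg: "\<And>t. t \<in> {a..b} \<Longrightarrow> 0 \<le> f t"
  shows "(\<integral>\<^sup>+ t\<in>{a..b}. ennreal (f t) \<partial>lborel) = ennreal (integral {a..b} f)"
proof -
  define F where "F t = indicator {a..b} t *\<^sub>R f t" for t
  have "(\<integral>\<^sup>+ t\<in>{a..b}. ennreal (f t) \<partial>lborel) = (\<integral>\<^sup>+ t. ennreal (F t) \<partial>lborel)"
    by (intro nn_integral_cong) (simp add: F_def indicator_def)
  also have "\<dots> = ennreal (integral {a..b} f)"
  proof (rule nn_integral_has_integral_lborel)
    show "F \<in> borel_measurable borel"
      unfolding F_def using f by (intro borel_measurable_continuous_on_indicator) auto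
    have "(f has_integral integral {a..b} f) {a..b}"
      using f by (intro integrable_integral integrable_continuous_interval)
    then have "((\<lambda>t. if t \<in> {a..b} then f t else 0) has_integral integral {a..b} f) UNIV"
      by (simp only: has_integral_restrict_UNIV)
    then show "(F has_integral integral {a..b} f) UNIV"
      by (rule has_integral_eq[rotated]) (auto simp: F_def indicator_def)
  qed (use nonneg in \<open>auto simp: F_def indicator_def\<close>)
  finally show ?thesis .
qed

lemma integral_powr_shift_le:
  fixes s \<delta> :: real
  assumes s: "0 < s" and \<delta>: "0 < \<delta>"
  shows "integral {1 / 2..1} (\<lambda>t. (1 - t + \<delta>) powr (- 1 - s)) \<le> \<delta> powr (- s) / s"
proof -
  have "((\<lambda>t. (1 - t + \<delta>) powr (- 1 - s)) has_integral
      ((1 - 1 + \<delta>) powr (- s) / s - (1 - 1 / 2 + \<delta>) powr (- s) / s)) {1 / 2..1}"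
  proof (rule fundamental_theorem_of_calculus)
    fix t :: real assume "t \<in> {1 / 2..1}"
    then have t: "0 < 1 - t + \<delta>" using \<delta> by auto
    have "((\<lambda>t. 1 - t + \<delta>) has_real_derivative - 1) (at t)"
      by (auto intro!: derivative_eq_intros)
    from DERIV_chain2[OF has_real_derivative_powr[OF t, of "- s"] this]
    have "((\<lambda>t. (1 - t + \<delta>) powr (- s)) has_real_derivative s * (1 - t + \<delta>) powr (- 1 - s)) (at t)"
      by (simp add: minus_diff_commute)
    from DERIV_cdivide[OF this, of s]
    have "((\<lambda>t. (1 - t + \<delta>) powr (- s) / s) has_real_derivative (1 - t + \<delta>) powr (- 1 - s)) (at t within {1 / 2..1})"
      using s by (simp add: has_field_derivative_at_within)
    then show "((\<lambda>t. (1 - t + \<delta>) powr (- s) / s) has_vector_derivative (1 - t + \<delta>) powr (- 1 - s)) (at t within {1 / 2..1})"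
      by (simp add: has_real_derivative_iff_has_vector_derivative)
  qed simp
  then show ?thesis using s by (simp add: integral_unique)
qed

text \<open>The auxiliary weight is \<open>(1 - t + \<delta>)^b\<close> with \<open>\<delta> = 1 - |z|\<close> and \<open>b = p - 1 + \<gamma>\<close>.  It is equivalent
  to \<open>(1 - t|z|)^b\<close>, since both \<open>1 - t\<close> and \<open>\<delta>\<close> are at most \<open>1 - t|z|\<close>, but its dual integral is
  elementary and of order \<open>\<delta>^(-\<gamma>)\<close> after taking the power \<open>p - 1\<close>; the exponent \<open>b > p - 1\<close> is what
  makes the end \<open>t = 1\<close> dominate.\<close>

lemma Hardy_pointwise:
  fixes u :: "complex ^ 'n::finite \<Rightarrow> real" and p \<gamma> :: real
  assumes p: "1 < p" and \<gamma>: "0 < \<gamma>" and u: "continuous_on unit_ball u" "\<And>x. x \<in> unit_ball \<Longrightarrow> 0 \<le> u x"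
    and z: "z \<in> unit_ball"
  shows "(integral {1 / 2..1} (\<lambda>t. u (t *\<^sub>R z))) powr p \<le>
    2 powr (p - 1 + \<gamma>) * (\<gamma> / (p - 1)) powr (1 - p) * (1 - norm z) powr (- \<gamma>) *
    integral {1 / 2..1} (\<lambda>t. u (t *\<^sub>R z) powr p * (1 - norm (t *\<^sub>R z)) powr (p - 1 + \<gamma>))"
proof -
  define \<delta> where "\<delta> = 1 - norm z"
  have \<delta>: "0 < \<delta>" using z by (simp add: \<delta>_def)
  define b where "b = p - 1 + \<gamma>"
  have b: "0 < b" using p \<gamma> by (simp add: b_def)
  define s where "s = \<gamma> / (p - 1)"
  have s: "0 < s" using p \<gamma> by (simp add: s_def)
  define w where "w t = (1 - t + \<delta>) powr b" for t
  have in_ball: "t *\<^sub>R z \<in> unit_ball" if "t \<in> {1 / 2..1}" for t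
    using z that by (auto intro!: le_less_trans[OF mult_left_le_one_le])
  have cu: "continuous_on {1 / 2..1} (\<lambda>t. u (t *\<^sub>R z))"
    by (rule continuous_on_compose2[OF u(1)]) (use in_ball in \<open>auto intro!: continuous_intros simp del: norm_scaleR\<close>)
  have pos: "0 < 1 - t + \<delta>" if "t \<in> {1 / 2..1}" for t using that \<delta> by auto
  have cw: "continuous_on {1 / 2..1} w"
    unfolding w_def using pos by (intro continuous_intros) force
  have wp: "w t powr (- 1 / (p - 1)) = (1 - t + \<delta>) powr (- 1 - s)" for t
  proof -
    have "b * (- 1 / (p - 1)) = - 1 - s" using p by (simp add: b_def s_def field_simps)
    then show ?thesis by (simp add: w_def powr_powr)
  qed
  have "(integral {1 / 2..1} (\<lambda>t. u (t *\<^sub>R z))) powr p \<le>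
      (\<delta> powr (- s) / s) powr (p - 1) * integral {1 / 2..1} (\<lambda>t. u (t *\<^sub>R z) powr p * w t)"
  proof (rule weighted_Holder_interval[OF p cu _ cw])
    show "integral {1 / 2..1} (\<lambda>t. w t powr (- 1 / (p - 1))) \<le> \<delta> powr (- s) / s"
      unfolding wp by (rule integral_powr_shift_le[OF s \<delta>])
    show "0 < w t" if "t \<in> {1 / 2..1}" for t using pos[OF that] by (simp add: w_def)
  qed (use u in_ball \<delta> s in auto)
  also have "(\<delta> powr (- s) / s) powr (p - 1) = s powr (1 - p) * \<delta> powr (- \<gamma>)"
  proof -
    have "s powr (1 - p) = inverse (s powr (p - 1))" using powr_minus[of s "p - 1"] by simp
    moreover have "- s * (p - 1) = - \<gamma>" using p by (simp add: s_def)
    moreover have "(\<delta> powr (- s) / s) powr (p - 1) = \<delta> powr (- s * (p - 1)) / s powr (p - 1)"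
      using s by (simp add: powr_divide powr_powr)
    ultimately show ?thesis by (simp add: divide_inverse mult.commute)
  qed
  also have "(s powr (1 - p) * \<delta> powr (- \<gamma>)) * integral {1 / 2..1} (\<lambda>t. u (t *\<^sub>R z) powr p * w t) \<le>
      (s powr (1 - p) * \<delta> powr (- \<gamma>)) *
      integral {1 / 2..1} (\<lambda>t. 2 powr b * (u (t *\<^sub>R z) powr p * (1 - norm (t *\<^sub>R z)) powr b))"
  proof (rule mult_left_mono[OF integral_le])
    show "(\<lambda>t. u (t *\<^sub>R z) powr p * w t) integrable_on {1 / 2..1}"
      using p u in_ball by (intro integrable_continuous_interval continuous_intros continuous_on_powr' cu cw) auto
    show "(\<lambda>t. 2 powr b * (u (t *\<^sub>R z) powr p * (1 - norm (t *\<^sub>R z)) powr b)) integrable_on {1 / 2..1}"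
      using p u b in_ball
      by (intro integrable_continuous_interval continuous_intros continuous_on_powr' cu) (auto simp: less_imp_le simp del: norm_scaleR)
    fix t :: real assume t: "t \<in> {1 / 2..1}"
    have tz: "norm (t *\<^sub>R z) \<le> t" "norm (t *\<^sub>R z) \<le> norm z"
      using t z mult_left_le[of "norm z" t] mult_left_le_one_le[of "norm z" t] by auto
    have "w t \<le> (2 * (1 - norm (t *\<^sub>R z))) powr b"
      unfolding w_def using b tz pos[OF t] by (intro powr_mono2) (auto simp: \<delta>_def)
    also have "\<dots> = 2 powr b * (1 - norm (t *\<^sub>R z)) powr b"
      using in_ball[OF t] by (intro powr_mult)
    finally have "u (t *\<^sub>R z) powr p * w t \<le> u (t *\<^sub>R z) powr p * (2 powr b * (1 - norm (t *\<^sub>R z)) powr b)"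
      by (intro mult_left_mono) auto
    then show "u (t *\<^sub>R z) powr p * w t \<le> 2 powr b * (u (t *\<^sub>R z) powr p * (1 - norm (t *\<^sub>R z)) powr b)"
      by (simp only: mult_ac)
  qed simp
  finally show ?thesis
    by (simp add: b_def[symmetric] \<delta>_def[symmetric] s_def[symmetric] mult_ac del: norm_scaleR)
qed

text \<open>With \<open>\<gamma> = (\<alpha> + 1)/2\<close>, the pointwise bound leaves the weight \<open>(1 - |z|)^(\<gamma> - 1)\<close> in \<open>z\<close>.  Exchanging the
  integrals and substituting \<open>w = tz\<close> turns it into \<open>(t - |w|)^(\<gamma> - 1)\<close> up to constants, because
  \<open>t \<ge> 1/2\<close>.  This is integrable in \<open>t\<close> from \<open>|w|\<close> to \<open>1\<close> as \<open>\<gamma> > 0\<close>, with value \<open>(1 - |w|)^\<gamma> / \<gamma>\<close>, and the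
  exponents add up to \<open>b + \<gamma> = \<alpha> + p\<close>.\<close>

proposition weighted_Hardy:
  fixes p \<alpha> :: real
  assumes p: "1 < p" and \<alpha>: "- 1 < \<alpha>"
  shows "\<exists>C>0. \<forall>u :: complex ^ 'n::finite \<Rightarrow> real. continuous_on unit_ball u \<longrightarrow> (\<forall>x\<in>unit_ball. 0 \<le> u x) \<longrightarrow>
    weighted_integral p \<alpha> (\<lambda>z. integral {1 / 2..1} (\<lambda>t. u (t *\<^sub>R z)))
      \<le> ennreal C * weighted_integral p (\<alpha> + p) u"
proof -
  define N where "N = DIM(complex ^ 'n)"
  define \<gamma> where "\<gamma> = (\<alpha> + 1) / 2"
  have \<gamma>: "0 < \<gamma>" using \<alpha> by (simp add: \<gamma>_def)
  define b where "b = p - 1 + \<gamma>"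
  define C1 where "C1 = 2 powr b * (\<gamma> / (p - 1)) powr (1 - p)"
  have C1: "0 < C1" using p \<gamma> by (simp add: C1_def)
  define C2 where "C2 = 2 ^ N * 2 powr \<bar>\<gamma> - 1\<bar>"
  have C2: "0 < C2" by (simp add: C2_def)
  have "weighted_integral p \<alpha> (\<lambda>z. integral {1 / 2..1} (\<lambda>t. u (t *\<^sub>R z)))
      \<le> ennreal (C1 * C2 / \<gamma>) * weighted_integral p (\<alpha> + p) u"
    if u: "continuous_on unit_ball u" "\<And>x. x \<in> unit_ball \<Longrightarrow> 0 \<le> u x" for u :: "complex ^ 'n \<Rightarrow> real"
  proof -
    define U where "U x = indicator unit_ball x *\<^sub>R u x" for x
    have [measurable]: "U \<in> borel_measurable borel"
      unfolding U_def by (rule borel_measurable_indicator_ball[OF u(1)])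
    define h where "h x = norm (U x) powr p * (1 - norm x) powr b" for x
    have [measurable]: "h \<in> borel_measurable borel" unfolding h_def by measurable
    have h0: "0 \<le> h x" for x by (simp add: h_def)
    define k where "k z = (if norm z < 1 then (1 - norm z) powr (\<gamma> - 1) else 0)" for z :: "complex ^ 'n"
    have [measurable]: "k \<in> borel_measurable borel" unfolding k_def by measurable
    have k0: "0 \<le> k z" for z by (simp add: k_def)
    \<comment> \<open>what becomes of the weight \<open>k\<close> under \<open>w = tz\<close>, up to constants\<close>
    define J where "J w t = (if norm w \<le> t \<and> t \<le> 1 then (t - norm w) powr (\<gamma> - 1) else 0)"
      for w :: "complex ^ 'n" and t :: real
    have [measurable]: "(\<lambda>(w, t). J w t) \<in> borel_measurable (borel \<Otimes>\<^sub>M borel)"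
      unfolding J_def by measurable
    have pointwise: "ennreal (norm (integral {1 / 2..1} (\<lambda>t. u (t *\<^sub>R z))) powr p * (1 - norm z) powr \<alpha>) * indicator unit_ball z
        \<le> ennreal C1 * (\<integral>\<^sup>+ t. ennreal (h (t *\<^sub>R z)) * ennreal (k z) * indicator {1 / 2..1} t \<partial>lborel)" for z
    proof (cases "z \<in> unit_ball")
      case True
      have in_ball: "t *\<^sub>R z \<in> unit_ball" if "t \<in> {1 / 2..1}" for t
        using True that by (auto intro!: le_less_trans[OF mult_left_le_one_le])
      have ht: "h (t *\<^sub>R z) = u (t *\<^sub>R z) powr p * (1 - norm (t *\<^sub>R z)) powr b" if "t \<in> {1 / 2..1}" for t
        using in_ball[OF that] u(2)[OF in_ball[OF that]] by (simp add: h_def U_def)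
      define I where "I = integral {1 / 2..1} (\<lambda>t. u (t *\<^sub>R z))"
      define j where "j = integral {1 / 2..1} (\<lambda>t. h (t *\<^sub>R z))"
      have cu: "continuous_on {1 / 2..1} (\<lambda>t. u (t *\<^sub>R z))"
        by (rule continuous_on_compose2[OF u(1)]) (use in_ball in \<open>auto intro!: continuous_intros simp del: norm_scaleR\<close>)
      have "continuous_on {1 / 2..1} (\<lambda>t. u (t *\<^sub>R z) powr p * (1 - norm (t *\<^sub>R z)) powr b)"
        using p \<gamma> u(2) in_ball
        by (intro continuous_intros continuous_on_powr' cu) (auto simp: less_imp_le b_def simp del: norm_scaleR)
      then have ch: "continuous_on {1 / 2..1} (\<lambda>t. h (t *\<^sub>R z))"
        by (rule continuous_on_eq) (simp add: ht)
      have j0: "0 \<le> j"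
        unfolding j_def by (intro integral_nonneg integrable_continuous_interval ch h0)
      have "0 \<le> I" unfolding I_def
        by (intro integral_nonneg integrable_continuous_interval cu) (use u(2) in_ball in blast)
      then have "norm I powr p \<le> C1 * (1 - norm z) powr (- \<gamma>) * j"
        using Hardy_pointwise[OF p \<gamma> u True] integral_cong[of "{1 / 2..1}" "\<lambda>t. h (t *\<^sub>R z)", OF ht]
        by (simp add: I_def[symmetric] j_def C1_def b_def del: norm_scaleR)
      then have "norm I powr p * (1 - norm z) powr \<alpha> \<le> C1 * (1 - norm z) powr (- \<gamma>) * j * (1 - norm z) powr \<alpha>"
        by (rule mult_right_mono) simp
      also have "\<dots> = C1 * j * ((1 - norm z) powr (- \<gamma>) * (1 - norm z) powr \<alpha>)" by (simp only: mult_ac)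
      also have "(1 - norm z) powr (- \<gamma>) * (1 - norm z) powr \<alpha> = k z"
      proof -
        have "- \<gamma> + \<alpha> = \<gamma> - 1" by (simp add: \<gamma>_def field_simps)
        then show ?thesis using True by (simp add: k_def powr_add[symmetric])
      qed
      finally have "ennreal (norm I powr p * (1 - norm z) powr \<alpha>) \<le> ennreal C1 * (ennreal j * ennreal (k z))"
        using C1 j0 k0 by (simp add: ennreal_mult[symmetric] ennreal_leI mult_ac)
      also have "ennreal j = (\<integral>\<^sup>+ t. ennreal (h (t *\<^sub>R z)) * indicator {1 / 2..1} t \<partial>lborel)"
        unfolding j_def by (rule nn_integral_continuous_interval[OF ch h0, symmetric])
      also have "\<dots> * ennreal (k z) = (\<integral>\<^sup>+ t. ennreal (h (t *\<^sub>R z)) * indicator {1 / 2..1} t * ennreal (k z) \<partial>lborel)"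
        by (rule nn_integral_multc[symmetric]) measurable
      finally show ?thesis using True by (simp add: I_def mult_ac)
    qed simp
    have inner: "(\<integral>\<^sup>+ z. ennreal (h (t *\<^sub>R z)) * ennreal (k z) * indicator {1 / 2..1} t \<partial>lborel)
        \<le> ennreal C2 * (\<integral>\<^sup>+ w. ennreal (h w) * ennreal (J w t) \<partial>lborel)" for t :: real
    proof (cases "t \<in> {1 / 2..1}")
      case True
      then have t: "1 / 2 \<le> t" "t \<le> 1" by auto
      have "(\<integral>\<^sup>+ z. ennreal (h (t *\<^sub>R z)) * ennreal (k z) * indicator {1 / 2..1} t \<partial>lborel)
          = (\<integral>\<^sup>+ z. ennreal (h (t *\<^sub>R z)) * ennreal (k z) \<partial>lborel)"
        using True by simp
      also have "\<dots> = ennreal (\<bar>1 / t\<bar> ^ N) * (\<integral>\<^sup>+ w. ennreal (h (t *\<^sub>R ((1 / t) *\<^sub>R w))) * ennreal (k ((1 / t) *\<^sub>R w)) \<partial>lborel)"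
        unfolding N_def using t by (intro nn_integral_lborel_scaleR) auto
      also have "\<dots> \<le> ennreal (2 ^ N) * (\<integral>\<^sup>+ w. ennreal (2 powr \<bar>\<gamma> - 1\<bar>) *
          (ennreal (h w) * ennreal (J w t)) \<partial>lborel)"
      proof (rule mult_mono, goal_cases)
        case 1
        have "\<bar>1 / t\<bar> ^ N \<le> 2 ^ N" using t by (intro power_mono) (auto simp: field_simps)
        then show ?case by (rule ennreal_leI)
      next
        case 2
        show ?case
        proof (rule nn_integral_mono)
          fix w :: "complex ^ 'n"
          have kw: "k ((1 / t) *\<^sub>R w) \<le> 2 powr \<bar>\<gamma> - 1\<bar> * (t - norm w) powr (\<gamma> - 1)" "norm w < t" if "k ((1 / t) *\<^sub>R w) \<noteq> 0"
          proof -
            have wt: "norm w < t" using that t by (auto simp: k_def field_simps split: if_splits)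
            then show "norm w < t" .
            have "(1 - norm w / t) powr (\<gamma> - 1) \<le> 2 powr \<bar>\<gamma> - 1\<bar> * (t - norm w) powr (\<gamma> - 1)"
            proof (rule powr_le_powr_comparable)
              have eq: "t * (1 - norm w / t) = t - norm w" using t by (simp add: field_simps)
              show p1: "0 < 1 - norm w / t" using wt t by (simp add: field_simps)
              have "1 / 2 * (1 - norm w / t) \<le> t * (1 - norm w / t)" using t p1 by (intro mult_right_mono) auto
              then show "1 - norm w / t \<le> 2 * (t - norm w)" by (simp add: eq)
              have "t * (1 - norm w / t) \<le> 2 * (1 - norm w / t)" using t p1 by (intro mult_right_mono) auto
              then show "t - norm w \<le> 2 * (1 - norm w / t)" by (simp add: eq)
            qed (use wt in auto)
            then show "k ((1 / t) *\<^sub>R w) \<le> 2 powr \<bar>\<gamma> - 1\<bar> * (t - norm w) powr (\<gamma> - 1)"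
              using wt t by (simp add: k_def)
          qed
          show "ennreal (h (t *\<^sub>R ((1 / t) *\<^sub>R w))) * ennreal (k ((1 / t) *\<^sub>R w))
              \<le> ennreal (2 powr \<bar>\<gamma> - 1\<bar>) * (ennreal (h w) * ennreal (J w t))"
          proof (cases "k ((1 / t) *\<^sub>R w) = 0")
            case False
            have "h w * k ((1 / t) *\<^sub>R w) \<le> h w * (2 powr \<bar>\<gamma> - 1\<bar> * (t - norm w) powr (\<gamma> - 1))"
              using kw(1)[OF False] h0 by (rule mult_left_mono)
            then have "ennreal (h w) * ennreal (k ((1 / t) *\<^sub>R w))
                \<le> ennreal (2 powr \<bar>\<gamma> - 1\<bar>) * (ennreal (h w) * ennreal ((t - norm w) powr (\<gamma> - 1)))"
              using h0 k0 by (simp add: ennreal_mult[symmetric] ennreal_leI mult_ac)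
            then show ?thesis using kw(2)[OF False] t by (simp add: J_def)
          qed simp
        qed
      qed auto
      also have "\<dots> = ennreal (2 ^ N) * (ennreal (2 powr \<bar>\<gamma> - 1\<bar>) * (\<integral>\<^sup>+ w.
          (ennreal (h w) * ennreal (J w t)) \<partial>lborel))"
      proof -
        have "(\<lambda>w. ennreal (h w) * ennreal (J w t)) \<in> borel_measurable lborel"
          by measurable
        then show ?thesis by (simp add: nn_integral_cmult)
      qed
      finally show ?thesis by (simp add: C2_def ennreal_mult mult.assoc)
    qed simp
    have "weighted_integral p \<alpha> (\<lambda>z. integral {1 / 2..1} (\<lambda>t. u (t *\<^sub>R z)))
        \<le> (\<integral>\<^sup>+ z. ennreal C1 * (\<integral>\<^sup>+ t. ennreal (h (t *\<^sub>R z)) * ennreal (k z) * indicator {1 / 2..1} t \<partial>lborel) \<partial>lborel)"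
      unfolding weighted_integral_def by (rule nn_integral_mono[OF pointwise])
    also have "\<dots> = ennreal C1 * (\<integral>\<^sup>+ z. \<integral>\<^sup>+ t. ennreal (h (t *\<^sub>R z)) * ennreal (k z) * indicator {1 / 2..1} t \<partial>lborel \<partial>lborel)"
      by (rule nn_integral_cmult) measurable
    also have "(\<integral>\<^sup>+ z. \<integral>\<^sup>+ t. ennreal (h (t *\<^sub>R z)) * ennreal (k z) * indicator {1 / 2..1} t \<partial>lborel \<partial>lborel)
        = (\<integral>\<^sup>+ t. \<integral>\<^sup>+ z. ennreal (h (t *\<^sub>R z)) * ennreal (k z) * indicator {1 / 2..1} t \<partial>lborel \<partial>lborel)"
      by (rule lborel_pair.Fubini') measurable
    also have "\<dots> \<le> (\<integral>\<^sup>+ t. ennreal C2 * (\<integral>\<^sup>+ w. ennreal (h w) * ennreal (J w t) \<partial>lborel) \<partial>lborel)"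
      by (rule nn_integral_mono[OF inner])
    also have "\<dots> = ennreal C2 * (\<integral>\<^sup>+ t. \<integral>\<^sup>+ w. ennreal (h w) * ennreal (J w t) \<partial>lborel \<partial>lborel)"
      by (rule nn_integral_cmult) measurable
    also have "(\<integral>\<^sup>+ t. \<integral>\<^sup>+ w. ennreal (h w) * ennreal (J w t) \<partial>lborel \<partial>lborel)
        = (\<integral>\<^sup>+ w. \<integral>\<^sup>+ t. ennreal (h w) * ennreal (J w t) \<partial>lborel \<partial>lborel)"
      by (rule lborel_pair.Fubini') measurable
    also have "\<dots> = (\<integral>\<^sup>+ w. ennreal (1 / \<gamma>) * ennreal (norm (U w) powr p * (1 - norm w) powr (\<alpha> + p)) \<partial>lborel)"
    proof (rule nn_integral_cong)
      fix w :: "complex ^ 'n"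
      show "(\<integral>\<^sup>+ t. ennreal (h w) * ennreal (J w t) \<partial>lborel)
          = ennreal (1 / \<gamma>) * ennreal (norm (U w) powr p * (1 - norm w) powr (\<alpha> + p))"
      proof (cases "w \<in> unit_ball")
        case True
        have "(\<integral>\<^sup>+ t. ennreal (h w) * ennreal (J w t) \<partial>lborel)
            = ennreal (h w) * ennreal ((1 - norm w) powr \<gamma> / \<gamma>)"
        proof -
          have "(\<integral>\<^sup>+ t. ennreal (J w t) \<partial>lborel) =
              (\<integral>\<^sup>+ t. ennreal ((t - norm w) powr (\<gamma> - 1)) * indicator {norm w..1} t \<partial>lborel)"
            by (intro nn_integral_cong) (simp add: J_def indicator_def)
          also have "\<dots> = ennreal ((1 - norm w) powr \<gamma> / \<gamma>)"
            using True \<gamma> by (intro nn_integral_powr_shift) auto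
          finally show ?thesis by (simp add: nn_integral_cmult)
        qed
        also have "\<dots> = ennreal (1 / \<gamma>) * ennreal (norm (U w) powr p * ((1 - norm w) powr b * (1 - norm w) powr \<gamma>))"
          using \<gamma> by (simp add: h_def ennreal_mult[symmetric] mult_ac)
        also have "(1 - norm w) powr b * (1 - norm w) powr \<gamma> = (1 - norm w) powr (\<alpha> + p)"
        proof -
          have "b + \<gamma> = \<alpha> + p" by (simp add: b_def \<gamma>_def field_simps)
          then show ?thesis by (simp add: powr_add[symmetric])
        qed
        finally show ?thesis .
      qed (simp add: h_def U_def)
    qed
    also have "\<dots> = ennreal (1 / \<gamma>) * weighted_integral p (\<alpha> + p) u"
      unfolding weighted_integral_indicator U_def[symmetric] by (rule nn_integral_cmult) measurable
    finally show ?thesis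
      using C1 C2 \<gamma> by (simp add: mult_left_mono ennreal_mult[symmetric] flip: mult.assoc)
  qed
  moreover have "0 < C1 * C2 / \<gamma>" using C1 C2 \<gamma> by simp
  ultimately show ?thesis by blast
qed


section \<open>Besov integrals as weighted integrals\<close>

lemma nn_integral_ball_measure:
  assumes "f \<in> borel_measurable (restrict_space lborel unit_ball)"
  shows "(\<integral>\<^sup>+ z. f z \<partial>(ball_measure :: (complex ^ 'n::finite) measure)) =
    1 / emeasure lborel (unit_ball :: (complex ^ 'n) set) * (\<integral>\<^sup>+ z\<in>unit_ball. f z \<partial>lborel)"
  using assms unfolding ball_measure_def
  by (simp add: nn_integral_scale_measure nn_integral_restrict_space)

lemma sets_ball_measure: "sets (ball_measure :: (complex ^ 'n::finite) measure) = sets (restrict_space borel unit_ball)"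
  by (simp add: ball_measure_def sets_restrict_space)

lemma space_ball_measure: "space (ball_measure :: (complex ^ 'n::finite) measure) = unit_ball"
  by (simp add: ball_measure_def space_scale_measure space_restrict_space)

lemma borel_measurable_ball_measure:
  "f \<in> borel_measurable ball_measure \<longleftrightarrow> f \<in> borel_measurable (restrict_space lborel unit_ball)"
  by (rule arg_cong[of _ _ "\<lambda>A. f \<in> A"], rule measurable_cong_sets)
     (simp_all add: sets_ball_measure sets_restrict_space)

lemma continuous_on_imp_measurable_ball_measure:
  fixes f :: "complex ^ 'n::finite \<Rightarrow> 'b::real_normed_vector"
  assumes "continuous_on unit_ball f"
  shows "f \<in> borel_measurable ball_measure"
  unfolding measurable_cong_sets[OF sets_ball_measure refl]
  by (rule borel_measurable_continuous_on_restrict[OF assms])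

definition ball_weighted_integral :: "real \<Rightarrow> real \<Rightarrow> (complex ^ 'n::finite \<Rightarrow> 'b::real_normed_vector) \<Rightarrow> ennreal" where
  "ball_weighted_integral p \<alpha> u =
     (\<integral>\<^sup>+ z. ennreal (norm (u z) powr p * (1 - (norm z)\<^sup>2) powr \<alpha>) \<partial>ball_measure)"

lemma measurable_id_ball_measure: "(\<lambda>z. z) \<in> ball_measure \<rightarrow>\<^sub>M borel"
  using continuous_on_imp_measurable_ball_measure[of "\<lambda>z. z"] by simp

lemma besov_integral_eq:
  fixes f :: "complex ^ 'n::finite \<Rightarrow> complex"
  assumes f: "holomorphic_ball f"
  shows "besov_integral p \<sigma> f =
    ball_weighted_integral p (p + \<sigma> * p - real CARD('n) - 1) (complex_gradient f)"
proof -
  note [measurable] = measurable_id_ball_measure continuous_on_imp_measurable_ball_measure[OF continuous_on_complex_gradient[OF f]]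
  have "besov_integral p \<sigma> f = (\<integral>\<^sup>+ z. ennreal ((1 - (norm z)\<^sup>2) powr (- real CARD('n) - 1)) *
      ennreal (((1 - (norm z)\<^sup>2) powr (1 + \<sigma>) * norm (complex_gradient f z)) powr p) \<partial>ball_measure)"
    unfolding besov_integral_def invariant_measure_def by (rule nn_integral_density) measurable
  also have "\<dots> = ball_weighted_integral p (p + \<sigma> * p - real CARD('n) - 1) (complex_gradient f)"
    unfolding ball_weighted_integral_def
  proof (rule nn_integral_cong)
    fix z :: "complex ^ 'n" assume "z \<in> space ball_measure"
    then have "0 < 1 - (norm z)\<^sup>2" by (simp add: space_ball_measure abs_square_less_1)
    have "(- real CARD('n) - 1) + (1 + \<sigma>) * p = p + \<sigma> * p - real CARD('n) - 1"
      by (simp add: algebra_simps)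
    then have "(1 - (norm z)\<^sup>2) powr (p + \<sigma> * p - real CARD('n) - 1) =
        (1 - (norm z)\<^sup>2) powr (- real CARD('n) - 1) * (1 - (norm z)\<^sup>2) powr ((1 + \<sigma>) * p)"
      by (simp only: powr_add[symmetric])
    then show "ennreal ((1 - (norm z)\<^sup>2) powr (- real CARD('n) - 1)) *
        ennreal (((1 - (norm z)\<^sup>2) powr (1 + \<sigma>) * norm (complex_gradient f z)) powr p) =
        ennreal (norm (complex_gradient f z) powr p * (1 - (norm z)\<^sup>2) powr (p + \<sigma> * p - real CARD('n) - 1))"
      by (simp add: ennreal_mult[symmetric] powr_mult powr_powr mult_ac)
  qed
  finally show ?thesis .
qed

lemma nn_integral_symbol_measure:
  fixes f :: "complex ^ 'n::finite \<Rightarrow> complex"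
  assumes f: "holomorphic_ball f" and \<phi>: "holomorphic_ball \<phi>"
  shows "(\<integral>\<^sup>+ z. ennreal (norm (f z) powr p) \<partial>symbol_measure p \<sigma> \<phi>) =
    ball_weighted_integral p (p + \<sigma> * p - real CARD('n) - 1) (\<lambda>z. f z * radial_deriv \<phi> z)"
proof -
  note [measurable] = measurable_id_ball_measure continuous_on_imp_measurable_ball_measure[OF holomorphic_ball_continuous_on[OF f]]
    continuous_on_imp_measurable_ball_measure[OF holomorphic_ball_continuous_on[OF holomorphic_ball_radial_deriv[OF \<phi>]]]
  have "(\<integral>\<^sup>+ z. ennreal (norm (f z) powr p) \<partial>symbol_measure p \<sigma> \<phi>) =
      (\<integral>\<^sup>+ z. ennreal (norm (radial_deriv \<phi> z) powr p *
          (1 - (norm z)\<^sup>2) powr (p + \<sigma> * p - real CARD('n) - 1)) * ennreal (norm (f z) powr p) \<partial>ball_measure)"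
    unfolding symbol_measure_def by (rule nn_integral_density) measurable
  then show ?thesis
    by (simp add: ball_weighted_integral_def ennreal_mult[symmetric] norm_mult powr_mult mult_ac)
qed

lemma ball_weighted_integral_comparable:
  fixes p \<alpha> :: real
  shows "\<exists>c>0. \<exists>C>0. \<forall>u :: complex ^ 'n::finite \<Rightarrow> 'b::real_normed_vector. continuous_on unit_ball u \<longrightarrow>
    ball_weighted_integral p \<alpha> u \<le> ennreal C * weighted_integral p \<alpha> u \<and>
    weighted_integral p \<alpha> u \<le> ennreal c * ball_weighted_integral p \<alpha> u"
proof -
  define V where "V = unit_ball_vol (DIM(complex ^ 'n))"
  have V: "0 < V" by (simp add: V_def unit_ball_vol_pos)
  have EV: "emeasure lborel (unit_ball :: (complex ^ 'n) set) = ennreal V"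
    by (simp add: V_def emeasure_ball)
  define D :: real where "D = 2 powr \<bar>\<alpha>\<bar>"
  have D: "0 < D" by (simp add: D_def)
  have "ball_weighted_integral p \<alpha> u \<le> ennreal (D / V) * weighted_integral p \<alpha> u \<and>
      weighted_integral p \<alpha> u \<le> ennreal (D * V) * ball_weighted_integral p \<alpha> u"
    if u: "continuous_on unit_ball u" for u :: "complex ^ 'n \<Rightarrow> 'b"
  proof -
    define U where "U x = indicator unit_ball x *\<^sub>R u x" for x
    have [measurable]: "U \<in> borel_measurable borel"
      unfolding U_def by (rule borel_measurable_indicator_ball[OF u])
    define Q where "Q = (\<integral>\<^sup>+ x. ennreal (norm (U x) powr p * (1 - (norm x)\<^sup>2) powr \<alpha>) \<partial>lborel)"
    have W: "weighted_integral p \<alpha> u = (\<integral>\<^sup>+ x. ennreal (norm (U x) powr p * (1 - norm x) powr \<alpha>) \<partial>lborel)"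
      by (simp add: weighted_integral_indicator U_def)
    have BQ: "ball_weighted_integral p \<alpha> u = ennreal (1 / V) * Q"
    proof -
      note [measurable] = measurable_id_ball_measure continuous_on_imp_measurable_ball_measure[OF u]
      have "(\<lambda>z. ennreal (norm (u z) powr p * (1 - (norm z)\<^sup>2) powr \<alpha>)) \<in> borel_measurable ball_measure"
        by measurable
      then have "ball_weighted_integral p \<alpha> u = 1 / ennreal V *
          (\<integral>\<^sup>+ z\<in>unit_ball. ennreal (norm (u z) powr p * (1 - (norm z)\<^sup>2) powr \<alpha>) \<partial>lborel)"
        unfolding ball_weighted_integral_def borel_measurable_ball_measure
        by (simp add: nn_integral_ball_measure EV)
      also have "(\<integral>\<^sup>+ z\<in>unit_ball. ennreal (norm (u z) powr p * (1 - (norm z)\<^sup>2) powr \<alpha>) \<partial>lborel) = Q"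
        unfolding Q_def by (intro nn_integral_cong) (simp add: U_def indicator_def)
      also have "1 / ennreal V = ennreal (1 / V)" using V by (simp add: divide_ennreal flip: ennreal_1)
      finally show ?thesis .
    qed
    have cmp: "(1 - (norm x)\<^sup>2) powr \<alpha> \<le> D * (1 - norm x) powr \<alpha>"
      "(1 - norm x) powr \<alpha> \<le> D * (1 - (norm x)\<^sup>2) powr \<alpha>" if "x \<in> unit_ball" for x :: "complex ^ 'n"
    proof -
      have n: "0 \<le> norm x" "norm x < 1" using that by auto
      have f: "1 - (norm x)\<^sup>2 = (1 + norm x) * (1 - norm x)" by (simp add: power2_eq_square algebra_simps)
      have "1 * (1 - norm x) \<le> (1 + norm x) * (1 - norm x)" "(1 + norm x) * (1 - norm x) \<le> 2 * (1 - norm x)"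
        using n by (intro mult_right_mono; simp)+
      then have b: "1 - norm x \<le> 1 - (norm x)\<^sup>2" "1 - (norm x)\<^sup>2 \<le> 2 * (1 - norm x)" by (simp_all add: f)
      have c1: "0 < 1 - norm x" and c2: "0 < 1 - (norm x)\<^sup>2" using n b by linarith+
      have c3: "1 - norm x \<le> 2 * (1 - (norm x)\<^sup>2)"
        using add_mono[OF b(1) less_imp_le[OF c2]] by simp
      show "(1 - (norm x)\<^sup>2) powr \<alpha> \<le> D * (1 - norm x) powr \<alpha>"
        unfolding D_def by (rule powr_le_powr_comparable[OF c2 c1 _ b(2) c3]) simp
      show "(1 - norm x) powr \<alpha> \<le> D * (1 - (norm x)\<^sup>2) powr \<alpha>"
        unfolding D_def by (rule powr_le_powr_comparable[OF c1 c2 _ c3]) (use b in simp_all)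
    qed
    have "Q \<le> (\<integral>\<^sup>+ x. ennreal D * ennreal (norm (U x) powr p * (1 - norm x) powr \<alpha>) \<partial>lborel)"
      unfolding Q_def
    proof (rule nn_integral_mono)
      fix x
      show "ennreal (norm (U x) powr p * (1 - (norm x)\<^sup>2) powr \<alpha>)
          \<le> ennreal D * ennreal (norm (U x) powr p * (1 - norm x) powr \<alpha>)"
      proof (cases "x \<in> unit_ball")
        case True
        have "norm (U x) powr p * (1 - (norm x)\<^sup>2) powr \<alpha> \<le> norm (U x) powr p * (D * (1 - norm x) powr \<alpha>)"
          using cmp(1)[OF True] by (intro mult_left_mono) auto
        then show ?thesis using D by (simp add: ennreal_mult[symmetric] ennreal_leI mult_ac)
      qed (simp add: U_def)
    qed
    also have "\<dots> = ennreal D * weighted_integral p \<alpha> u"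
      unfolding W by (rule nn_integral_cmult) measurable
    finally have QW: "Q \<le> ennreal D * weighted_integral p \<alpha> u" .
    have "weighted_integral p \<alpha> u \<le> (\<integral>\<^sup>+ x. ennreal D * ennreal (norm (U x) powr p * (1 - (norm x)\<^sup>2) powr \<alpha>) \<partial>lborel)"
      unfolding W
    proof (rule nn_integral_mono)
      fix x
      show "ennreal (norm (U x) powr p * (1 - norm x) powr \<alpha>)
          \<le> ennreal D * ennreal (norm (U x) powr p * (1 - (norm x)\<^sup>2) powr \<alpha>)"
      proof (cases "x \<in> unit_ball")
        case True
        have "norm (U x) powr p * (1 - norm x) powr \<alpha> \<le> norm (U x) powr p * (D * (1 - (norm x)\<^sup>2) powr \<alpha>)"
          using cmp(2)[OF True] by (intro mult_left_mono) auto
        then show ?thesis using D by (simp add: ennreal_mult[symmetric] ennreal_leI mult_ac)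
      qed (simp add: U_def)
    qed
    also have "\<dots> = ennreal D * Q"
      unfolding Q_def by (rule nn_integral_cmult) measurable
    finally have WQ: "weighted_integral p \<alpha> u \<le> ennreal D * Q" .
    have "ennreal (D * V) * (ennreal (1 / V) * Q) = ennreal D * Q"
      using D V by (simp add: mult.assoc[symmetric] ennreal_mult[symmetric])
    moreover have "ennreal (1 / V) * (ennreal D * I) = ennreal (D / V) * I" for I
      using D V by (simp add: mult.assoc[symmetric] ennreal_mult[symmetric])
    ultimately show ?thesis
      using WQ mult_left_mono[OF QW, of "ennreal (1 / V)"] by (simp add: BQ)
  qed
  moreover have "0 < D / V" "0 < D * V" using D V by auto
  ultimately show ?thesis by blast
qed

section \<open>The gradient is controlled by the radial derivative\<close>

text \<open>On \<open>0 \<le> t \<le> 1/2\<close> the integrand is at most \<open>S\<close>.  Since both halves of the unit interval have the same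
  length, this contribution may be written as an integral of \<open>S\<close> over \<open>1/2 \<le> t \<le> 1\<close>, so that
  Hardy's inequality can be applied to \<open>|\<nabla>g| + S\<close>.\<close>

lemma norm_gradient_ray_integral_le:
  fixes g :: "complex ^ 'n::finite \<Rightarrow> complex"
  assumes g: "holomorphic_ball g" and z: "z \<in> unit_ball"
    and S: "\<And>w. norm w \<le> 1 / 2 \<Longrightarrow> norm (complex_gradient g w) \<le> S"
  shows "norm (integral {0..1} (\<lambda>t. complex_gradient g (t *\<^sub>R z)))
    \<le> integral {1 / 2..1} (\<lambda>t. norm (complex_gradient g (t *\<^sub>R z)) + S)"
proof -
  let ?G = "\<lambda>t. complex_gradient g (t *\<^sub>R z)"
  note cont = continuous_on_gradient_ray[OF g z]
  have nint: "(\<lambda>t. norm (?G t)) integrable_on {0..1}"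
    by (intro integrable_continuous_interval continuous_on_norm cont)
  have cont2: "continuous_on {1 / 2..1} ?G"
    by (rule continuous_on_subset[OF cont]) auto
  have "norm (integral {0..1} ?G) \<le> integral {0..1} (\<lambda>t. norm (?G t))"
    by (rule integral_norm_bound_integral[OF integrable_continuous_interval[OF cont] nint]) simp
  also have "\<dots> = integral {0..1 / 2} (\<lambda>t. norm (?G t)) + integral {1 / 2..1} (\<lambda>t. norm (?G t))"
    by (rule Henstock_Kurzweil_Integration.integral_combine[symmetric, OF _ _ nint]) auto
  also have "integral {0..1 / 2} (\<lambda>t. norm (?G t)) \<le> integral {0..1 / 2} (\<lambda>t::real. S)"
  proof (rule integral_le)
    show "(\<lambda>t. norm (?G t)) integrable_on {0..1 / 2}"
      by (rule integrable_subinterval_real[OF nint]) auto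
    fix t :: real assume t: "t \<in> {0..1 / 2}"
    have "t * norm z \<le> 1 / 2 * 1" using t z by (intro mult_mono) auto
    then show "norm (?G t) \<le> S" using t by (intro S) simp
  qed (rule integrable_continuous_interval, simp)
  also have "integral {0..1 / 2} (\<lambda>t::real. S) = integral {1 / 2..1} (\<lambda>t::real. S)" by simp
  also have "integral {1 / 2..1} (\<lambda>t::real. S) + integral {1 / 2..1} (\<lambda>t. norm (?G t)) =
      integral {1 / 2..1} (\<lambda>t. norm (?G t) + S)"
    by (subst integral_add)
       (auto intro!: integrable_continuous_interval continuous_on_norm cont2)
  finally show ?thesis by simp
qed

lemma weighted_integral_add_const_le:
  fixes u :: "complex ^ 'n::finite \<Rightarrow> 'b::real_normed_vector" and p \<beta> S :: real
  assumes u: "continuous_on unit_ball u" and p: "0 < p" and \<beta>: "0 \<le> \<beta>" and S: "0 \<le> S"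
  shows "weighted_integral p \<beta> (\<lambda>x. norm (u x) + S) \<le>
    ennreal (2 powr p) * (weighted_integral p \<beta> u + ennreal (S powr p) * emeasure lborel (unit_ball :: (complex ^ 'n) set))"
proof -
  define U where "U x = indicator unit_ball x *\<^sub>R u x" for x
  have [measurable]: "U \<in> borel_measurable borel"
    unfolding U_def by (rule borel_measurable_indicator_ball[OF u])
  have m1: "(\<lambda>x. ennreal (norm (U x) powr p * (1 - norm x) powr \<beta>)) \<in> borel_measurable lborel"
    by measurable
  have m2: "(\<lambda>x. ennreal (S powr p) * indicator unit_ball x) \<in> borel_measurable (lborel :: (complex ^ 'n) measure)"
    by (intro borel_measurable_times_ennreal borel_measurable_indicator) auto
  have "weighted_integral p \<beta> (\<lambda>x. norm (u x) + S) \<le>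
      (\<integral>\<^sup>+ x. ennreal (2 powr p) * (ennreal (norm (U x) powr p * (1 - norm x) powr \<beta>) +
         ennreal (S powr p) * indicator unit_ball x) \<partial>lborel)"
    unfolding weighted_integral_def
  proof (rule nn_integral_mono)
    fix x :: "complex ^ 'n"
    show "ennreal (norm (norm (u x) + S) powr p * (1 - norm x) powr \<beta>) * indicator unit_ball x
        \<le> ennreal (2 powr p) * (ennreal (norm (U x) powr p * (1 - norm x) powr \<beta>) +
           ennreal (S powr p) * indicator unit_ball x)"
    proof (cases "x \<in> unit_ball")
      case True
      define d where "d = (1 - norm x) powr \<beta>"
      have d: "0 \<le> d" "d \<le> 1" using True \<beta> by (auto simp: d_def intro: powr_le1)
      have "(norm (u x) + S) powr p \<le> (2 * max (norm (u x)) S) powr p"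
        using p S by (intro powr_mono2) auto
      also have "\<dots> = 2 powr p * max (norm (u x)) S powr p" using S by (intro powr_mult)
      also have "\<dots> \<le> 2 powr p * (norm (u x) powr p + S powr p)"
        by (intro mult_left_mono) (auto simp: max_def)
      finally have "(norm (u x) + S) powr p * d \<le> 2 powr p * (norm (u x) powr p + S powr p) * d"
        using d by (intro mult_right_mono) auto
      also have "\<dots> = 2 powr p * (norm (u x) powr p * d + S powr p * d)" by (simp add: algebra_simps)
      also have "\<dots> \<le> 2 powr p * (norm (u x) powr p * d + S powr p * 1)"
        using d by (intro mult_left_mono add_left_mono) auto
      finally have "ennreal ((norm (u x) + S) powr p * d) \<le> ennreal (2 powr p * (norm (u x) powr p * d + S powr p))"
        by (simp only: mult_1_right ennreal_leI)
      also have "\<dots> = ennreal (2 powr p) * (ennreal (norm (u x) powr p * d) + ennreal (S powr p))"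
        using d by (subst ennreal_mult) auto
      finally have le: "ennreal ((norm (u x) + S) powr p * d) \<le>
        ennreal (2 powr p) * (ennreal (norm (u x) powr p * d) + ennreal (S powr p))" .
      have 1: "norm (norm (u x) + S) = norm (u x) + S" using S by simp
      have 2: "indicator unit_ball x = (1 :: ennreal)" using True by simp
      have 3: "U x = u x" using True by (simp add: U_def)
      show ?thesis unfolding 1 2 3 d_def[symmetric] mult_1_right by (rule le)
    qed simp
  qed
  also have "\<dots> = ennreal (2 powr p) * (\<integral>\<^sup>+ x. (ennreal (norm (U x) powr p * (1 - norm x) powr \<beta>) +
         ennreal (S powr p) * indicator unit_ball x) \<partial>lborel)"
    by (rule nn_integral_cmult[OF borel_measurable_add[OF m1 m2]])
  also have "(\<integral>\<^sup>+ x. (ennreal (norm (U x) powr p * (1 - norm x) powr \<beta>) +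
         ennreal (S powr p) * indicator unit_ball x) \<partial>lborel) =
      (\<integral>\<^sup>+ x. ennreal (norm (U x) powr p * (1 - norm x) powr \<beta>) \<partial>lborel) +
      ennreal (S powr p) * emeasure lborel (unit_ball :: (complex ^ 'n) set)"
    unfolding nn_integral_add[OF m1 m2] by (simp only: nn_integral_cmult_indicator sets_lborel borel_open open_ball)
  finally show ?thesis unfolding weighted_integral_indicator[of p \<beta> u] U_def[symmetric] .
qed

text \<open>Here \<open>g\<close> plays the role of the radial derivative and the ray integral that of the full gradient: the
  loss of \<open>p\<close> powers of the weight in passing to \<open>\<nabla>g\<close> and the gain in Hardy's inequality cancel.\<close>

proposition ray_integral_gradient_weighted_integral_le:
  fixes p \<alpha> :: real
  assumes p: "1 < p" and \<alpha>: "- 1 < \<alpha>"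
  shows "\<exists>C>0. \<forall>g :: complex ^ 'n::finite \<Rightarrow> complex. holomorphic_ball g \<longrightarrow>
    weighted_integral p \<alpha> (\<lambda>z. integral {0..1} (\<lambda>t. complex_gradient g (t *\<^sub>R z)))
      \<le> ennreal C * weighted_integral p \<alpha> g"
proof -
  have p0: "0 < p" using p by simp
  define V where "V = unit_ball_vol (DIM(complex ^ 'n))"
  have V: "0 < V" by (simp add: V_def unit_ball_vol_pos)
  obtain C1 where C1: "0 < C1" and near: "\<And>(g :: complex ^ 'n \<Rightarrow> complex) w. holomorphic_ball g \<Longrightarrow> norm w \<le> 1 / 2 \<Longrightarrow>
      ennreal (norm (complex_gradient g w) powr p) \<le> ennreal C1 * weighted_integral p \<alpha> g"
    using gradient_le_weighted_integral[OF p0, where 'n = 'n and \<alpha> = \<alpha>] by blast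
  obtain C2 where C2: "0 < C2" and grad: "\<And>g :: complex ^ 'n \<Rightarrow> complex. holomorphic_ball g \<Longrightarrow>
      weighted_integral p (\<alpha> + p) (complex_gradient g) \<le> ennreal C2 * weighted_integral p \<alpha> g"
    using gradient_weighted_integral_le[OF p0, where 'n = 'n and \<alpha> = \<alpha>] by blast
  obtain C3 where C3: "0 < C3" and Hardy: "\<And>u :: complex ^ 'n \<Rightarrow> real. continuous_on unit_ball u \<Longrightarrow>
      (\<forall>x\<in>unit_ball. 0 \<le> u x) \<Longrightarrow> weighted_integral p \<alpha> (\<lambda>z. integral {1 / 2..1} (\<lambda>t. u (t *\<^sub>R z)))
      \<le> ennreal C3 * weighted_integral p (\<alpha> + p) u"
    using weighted_Hardy[OF p \<alpha>, where 'n = 'n] by blast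
  define C where "C = C3 * (2 powr p * (C2 + C1 * V))"
  have C: "0 < C" using C1 C2 C3 V by (simp add: C_def add_pos_pos)
  have main: "weighted_integral p \<alpha> (\<lambda>z. integral {0..1} (\<lambda>t. complex_gradient g (t *\<^sub>R z)))
      \<le> ennreal C * weighted_integral p \<alpha> g"
    if g: "holomorphic_ball g" for g :: "complex ^ 'n \<Rightarrow> complex"
  proof (cases "weighted_integral p \<alpha> g")
    case top
    then show ?thesis using C by (simp add: ennreal_mult_top)
  next
    case (real \<omega>)
    define S where "S = (C1 * \<omega>) powr (1 / p)"
    have S: "0 \<le> S" by (simp add: S_def)
    have Sp: "S powr p = C1 * \<omega>" using C1 real p by (simp add: S_def powr_powr)
    have grad_S: "norm (complex_gradient g w) \<le> S" if "norm w \<le> 1 / 2" for w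
    proof -
      have "ennreal (norm (complex_gradient g w) powr p) \<le> ennreal (C1 * \<omega>)"
        using near[OF g that] real C1 by (simp add: ennreal_mult)
      then have "norm (complex_gradient g w) powr p \<le> C1 * \<omega>" using real C1 by simp
      then have "(norm (complex_gradient g w) powr p) powr (1 / p) \<le> S"
        unfolding S_def using p by (intro powr_mono2) auto
      then show ?thesis using p by (simp add: powr_powr)
    qed
    define U where "U x = norm (complex_gradient g x) + S" for x
    note cg = continuous_on_complex_gradient[OF g]
    have "weighted_integral p \<alpha> (\<lambda>z. integral {0..1} (\<lambda>t. complex_gradient g (t *\<^sub>R z)))
        \<le> weighted_integral p \<alpha> (\<lambda>z. integral {1 / 2..1} (\<lambda>t. U (t *\<^sub>R z)))"
      unfolding weighted_integral_def
    proof (rule nn_integral_mono)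
      fix z :: "complex ^ 'n"
      show "ennreal (norm (integral {0..1} (\<lambda>t. complex_gradient g (t *\<^sub>R z))) powr p * (1 - norm z) powr \<alpha>) * indicator unit_ball z
          \<le> ennreal (norm (integral {1 / 2..1} (\<lambda>t. U (t *\<^sub>R z))) powr p * (1 - norm z) powr \<alpha>) * indicator unit_ball z"
      proof (cases "z \<in> unit_ball")
        case True
        have "norm (integral {0..1} (\<lambda>t. complex_gradient g (t *\<^sub>R z))) \<le> norm (integral {1 / 2..1} (\<lambda>t. U (t *\<^sub>R z)))"
          using norm_gradient_ray_integral_le[OF g True grad_S] by (simp add: U_def)
        then show ?thesis
          using p by (intro mult_right_mono ennreal_leI powr_mono2) auto
      qed simp
    qed
    also have "\<dots> \<le> ennreal C3 * weighted_integral p (\<alpha> + p) U"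
      using S by (intro Hardy) (auto simp: U_def intro!: continuous_intros cg)
    also have "\<dots> \<le> ennreal C3 * (ennreal (2 powr p) * (weighted_integral p (\<alpha> + p) (complex_gradient g)
        + ennreal (S powr p) * ennreal V))"
      using weighted_integral_add_const_le[OF cg p0 _ S, of "\<alpha> + p"] p \<alpha>
      by (intro mult_left_mono) (auto simp: U_def[abs_def] V_def emeasure_ball)
    also have "\<dots> \<le> ennreal C3 * (ennreal (2 powr p) * (ennreal C2 * ennreal \<omega>
        + ennreal (C1 * \<omega>) * ennreal V))"
      using grad[OF g] real by (intro mult_left_mono add_right_mono) (auto simp: Sp)
    also have "\<dots> = ennreal (C3 * (2 powr p * (C2 * \<omega> + C1 * \<omega> * V)))"
      using C1 C2 C3 V real
      by (simp add: ennreal_mult[symmetric] ennreal_plus[symmetric] del: ennreal_plus)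
    also have "C3 * (2 powr p * (C2 * \<omega> + C1 * \<omega> * V)) = C * \<omega>" by (simp add: C_def algebra_simps)
    also have "ennreal (C * \<omega>) = ennreal C * ennreal \<omega>" using C real by (intro ennreal_mult) auto
    finally show ?thesis using real by simp
  qed
  show ?thesis by (intro exI[of _ C] conjI C allI impI main)
qed

section \<open>The Riemann-Stieltjes operator\<close>

lemma radial_deriv_0 [simp]: "radial_deriv \<phi> 0 = 0"
  by (simp add: radial_deriv_def)

lemma riemann_stieltjes_op_0: "riemann_stieltjes_op \<phi> f 0 = 0"
  by (simp add: riemann_stieltjes_op_def)

context
  fixes \<phi> f :: "complex ^ 'n::finite \<Rightarrow> complex"
  assumes \<phi>: "holomorphic_ball \<phi>" and f: "holomorphic_ball f"
begin

lemma holomorphic_ball_op_density: "holomorphic_ball (\<lambda>z. f z * radial_deriv \<phi> z)"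
  by (rule holomorphic_ball_mult[OF f holomorphic_ball_radial_deriv[OF \<phi>]])

lemma riemann_stieltjes_op_has_derivative:
  assumes "z \<in> unit_ball"
  shows "(riemann_stieltjes_op \<phi> f has_derivative
    complex_dot (integral {0..1} (\<lambda>t. complex_gradient (\<lambda>z. f z * radial_deriv \<phi> z) (t *\<^sub>R z)))) (at z)"
  unfolding riemann_stieltjes_op_def[abs_def]
  by (rule has_derivative_radial_primitive[OF holomorphic_ball_op_density _ assms]) simp

lemma holomorphic_ball_riemann_stieltjes_op: "holomorphic_ball (riemann_stieltjes_op \<phi> f)"
  by (rule holomorphic_ballI[OF riemann_stieltjes_op_has_derivative])

lemma complex_gradient_riemann_stieltjes_op:
  "z \<in> unit_ball \<Longrightarrow> complex_gradient (riemann_stieltjes_op \<phi> f) z =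
    integral {0..1} (\<lambda>t. complex_gradient (\<lambda>z. f z * radial_deriv \<phi> z) (t *\<^sub>R z))"
  by (rule complex_gradient_unique[OF riemann_stieltjes_op_has_derivative])

lemma radial_deriv_riemann_stieltjes_op:
  "z \<in> unit_ball \<Longrightarrow> radial_deriv (riemann_stieltjes_op \<phi> f) z = f z * radial_deriv \<phi> z"
  using complex_dot_ray_integral_gradient[OF holomorphic_ball_op_density, of z]
  by (simp add: radial_deriv_eq[of "riemann_stieltjes_op \<phi> f"] complex_gradient_riemann_stieltjes_op)

lemma radial_integral_le_besov_integral:
  assumes "0 < p"
  shows "ball_weighted_integral p (p + \<sigma> * p - real CARD('n) - 1) (\<lambda>z. f z * radial_deriv \<phi> z)
    \<le> besov_integral p \<sigma> (riemann_stieltjes_op \<phi> f)"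
  unfolding besov_integral_eq[OF holomorphic_ball_riemann_stieltjes_op]
  unfolding ball_weighted_integral_def
proof (rule nn_integral_mono)
  fix z :: "complex ^ 'n" assume "z \<in> space ball_measure"
  then have z: "z \<in> unit_ball" by (simp add: space_ball_measure)
  let ?F = "riemann_stieltjes_op \<phi> f"
  have "norm (f z * radial_deriv \<phi> z) = norm (complex_dot (complex_gradient ?F z) z)"
    using radial_deriv_riemann_stieltjes_op[OF z] by (simp add: radial_deriv_eq)
  also have "\<dots> \<le> norm (complex_gradient ?F z) * norm z" by (rule norm_complex_dot_le)
  also have "\<dots> \<le> norm (complex_gradient ?F z)" using z by (intro mult_left_le) auto
  finally show "ennreal (norm (f z * radial_deriv \<phi> z) powr p * (1 - (norm z)\<^sup>2) powr (p + \<sigma> * p - real CARD('n) - 1))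
      \<le> ennreal (norm (complex_gradient ?F z) powr p * (1 - (norm z)\<^sup>2) powr (p + \<sigma> * p - real CARD('n) - 1))"
    using assms by (intro ennreal_leI mult_right_mono powr_mono2) auto
qed

end

proposition besov_integral_riemann_stieltjes_op_le:
  fixes p \<sigma> :: real
  assumes p: "1 < p" and \<sigma>: "1 + \<sigma> > real CARD('n::finite) / p"
  shows "\<exists>C>0. \<forall>\<phi> f :: complex ^ 'n \<Rightarrow> complex. holomorphic_ball \<phi> \<longrightarrow> holomorphic_ball f \<longrightarrow>
    besov_integral p \<sigma> (riemann_stieltjes_op \<phi> f) \<le>
      ennreal C * ball_weighted_integral p (p + \<sigma> * p - real CARD('n) - 1) (\<lambda>z. f z * radial_deriv \<phi> z)"
proof -
  define \<alpha> where "\<alpha> = p + \<sigma> * p - real CARD('n) - 1"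
  have "real CARD('n) < (1 + \<sigma>) * p" using \<sigma> p by (simp add: field_simps)
  then have \<alpha>: "- 1 < \<alpha>" by (simp add: \<alpha>_def algebra_simps)
  obtain C1 where C1: "0 < C1" and main: "\<And>g :: complex ^ 'n \<Rightarrow> complex. holomorphic_ball g \<Longrightarrow>
    weighted_integral p \<alpha> (\<lambda>z. integral {0..1} (\<lambda>t. complex_gradient g (t *\<^sub>R z)))
      \<le> ennreal C1 * weighted_integral p \<alpha> g"
    using ray_integral_gradient_weighted_integral_le[OF p \<alpha>, where 'n = 'n] by blast
  obtain C2 where C2: "0 < C2" and up: "\<And>u :: complex ^ 'n \<Rightarrow> complex ^ 'n. continuous_on unit_ball u \<Longrightarrow>
      ball_weighted_integral p \<alpha> u \<le> ennreal C2 * weighted_integral p \<alpha> u"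
    using ball_weighted_integral_comparable[of p \<alpha>, where 'n = 'n and 'b = "complex ^ 'n"] by blast
  obtain C3 where C3: "0 < C3" and low: "\<And>u :: complex ^ 'n \<Rightarrow> complex. continuous_on unit_ball u \<Longrightarrow>
      weighted_integral p \<alpha> u \<le> ennreal C3 * ball_weighted_integral p \<alpha> u"
    using ball_weighted_integral_comparable[of p \<alpha>, where 'n = 'n and 'b = complex] by blast
  have "besov_integral p \<sigma> (riemann_stieltjes_op \<phi> f) \<le>
      ennreal (C2 * (C1 * C3)) * ball_weighted_integral p \<alpha> (\<lambda>z. f z * radial_deriv \<phi> z)"
    if \<phi>: "holomorphic_ball \<phi>" and f: "holomorphic_ball f" for \<phi> f :: "complex ^ 'n \<Rightarrow> complex"
  proof -
    let ?F = "riemann_stieltjes_op \<phi> f" and ?g = "\<lambda>z. f z * radial_deriv \<phi> z"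
    note F = holomorphic_ball_riemann_stieltjes_op[OF \<phi> f] and g = holomorphic_ball_op_density[OF \<phi> f]
    have "besov_integral p \<sigma> ?F = ball_weighted_integral p \<alpha> (complex_gradient ?F)"
      unfolding \<alpha>_def by (rule besov_integral_eq[OF F])
    also have "\<dots> \<le> ennreal C2 * weighted_integral p \<alpha> (complex_gradient ?F)"
      by (rule up[OF continuous_on_complex_gradient[OF F]])
    also have "weighted_integral p \<alpha> (complex_gradient ?F) =
        weighted_integral p \<alpha> (\<lambda>z. integral {0..1} (\<lambda>t. complex_gradient ?g (t *\<^sub>R z)))"
      unfolding weighted_integral_def
      by (intro nn_integral_cong) (auto simp: indicator_def complex_gradient_riemann_stieltjes_op[OF \<phi> f])
    also have "ennreal C2 * \<dots> \<le> ennreal C2 * (ennreal C1 * (ennreal C3 * ball_weighted_integral p \<alpha> ?g))"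
      by (intro mult_left_mono order_trans[OF main[OF g]] low holomorphic_ball_continuous_on g) simp_all
    finally show ?thesis using C1 C2 C3 by (simp add: ennreal_mult mult.assoc)
  qed
  moreover have "0 < C2 * (C1 * C3)" using C1 C2 C3 by simp
  ultimately show ?thesis unfolding \<alpha>_def by blast
qed

lemma besov_norm_powr:
  assumes "0 < p"
  shows "besov_norm p \<sigma> f powr p = norm (f 0) powr p + enn2real (besov_integral p \<sigma> f)"
  using assms by (simp add: besov_norm_def powr_powr)

theorem theorem3p2:
  fixes \<phi> :: "complex ^ 'n::finite \<Rightarrow> complex" and p \<sigma> :: real
  assumes "CARD('n) > 1"
    and "holomorphic_ball \<phi>"
    and "1 < p" and "0 \<le> \<sigma>" and "1 + \<sigma> > real CARD('n) / p"
  shows "besov_bounded p \<sigma> (riemann_stieltjes_op \<phi>) \<longleftrightarrow>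
    carleson_measure p \<sigma> (symbol_measure p \<sigma> \<phi>)"
proof
  note \<phi> = \<open>holomorphic_ball \<phi>\<close> and p = \<open>1 < p\<close>
  assume "besov_bounded p \<sigma> (riemann_stieltjes_op \<phi>)"
  then obtain C where maps: "\<And>f :: complex ^ 'n \<Rightarrow> complex. f \<in> besov_space p \<sigma> \<Longrightarrow> riemann_stieltjes_op \<phi> f \<in> besov_space p \<sigma>"
    and C: "0 < C" and bound: "\<And>f :: complex ^ 'n \<Rightarrow> complex. f \<in> besov_space p \<sigma> \<Longrightarrow>
      besov_norm p \<sigma> (riemann_stieltjes_op \<phi> f) \<le> C * besov_norm p \<sigma> f"
    unfolding besov_bounded_def by blast
  have "(\<integral>\<^sup>+ z. ennreal (norm (f z) powr p) \<partial>symbol_measure p \<sigma> \<phi>)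
      \<le> ennreal (C powr p * besov_norm p \<sigma> f powr p)" if f: "f \<in> besov_space p \<sigma>"
    for f :: "complex ^ 'n \<Rightarrow> complex"
  proof -
    let ?F = "riemann_stieltjes_op \<phi> f"
    have hf: "holomorphic_ball f" using f by (simp add: besov_space_def)
    have "(\<integral>\<^sup>+ z. ennreal (norm (f z) powr p) \<partial>symbol_measure p \<sigma> \<phi>) \<le> besov_integral p \<sigma> ?F"
      unfolding nn_integral_symbol_measure[OF hf \<phi>]
      using p by (intro radial_integral_le_besov_integral[OF \<phi> hf]) simp
    also have "\<dots> = ennreal (enn2real (besov_integral p \<sigma> ?F))"
      using maps[OF f] by (simp add: besov_space_def)
    also have "\<dots> \<le> ennreal (besov_norm p \<sigma> ?F powr p)"
      using p by (intro ennreal_leI) (simp add: besov_norm_powr)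
    also have "\<dots> \<le> ennreal ((C * besov_norm p \<sigma> f) powr p)"
      using bound[OF f] p by (intro ennreal_leI powr_mono2) (auto simp: besov_norm_def)
    also have "\<dots> = ennreal (C powr p * besov_norm p \<sigma> f powr p)"
      using C by (simp add: powr_mult besov_norm_def)
    finally show ?thesis .
  qed
  moreover have "sets (symbol_measure p \<sigma> \<phi>) = sets (restrict_space borel unit_ball)"
    by (simp add: symbol_measure_def sets_ball_measure sets_restrict_space)
  moreover have "0 < C powr p" using C by simp
  ultimately show "carleson_measure p \<sigma> (symbol_measure p \<sigma> \<phi>)"
    unfolding carleson_measure_def by blast
next
  note \<phi> = \<open>holomorphic_ball \<phi>\<close> and p = \<open>1 < p\<close>
  assume "carleson_measure p \<sigma> (symbol_measure p \<sigma> \<phi>)"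
  then obtain C where C: "0 < C" and carleson: "\<And>f :: complex ^ 'n \<Rightarrow> complex. f \<in> besov_space p \<sigma> \<Longrightarrow>
      (\<integral>\<^sup>+ z. ennreal (norm (f z) powr p) \<partial>symbol_measure p \<sigma> \<phi>) \<le> ennreal (C * besov_norm p \<sigma> f powr p)"
    unfolding carleson_measure_def by blast
  obtain K where K: "0 < K" and op: "\<And>\<phi> f :: complex ^ 'n \<Rightarrow> complex. holomorphic_ball \<phi> \<Longrightarrow> holomorphic_ball f \<Longrightarrow>
    besov_integral p \<sigma> (riemann_stieltjes_op \<phi> f) \<le>
      ennreal K * ball_weighted_integral p (p + \<sigma> * p - real CARD('n) - 1) (\<lambda>z. f z * radial_deriv \<phi> z)"
    using besov_integral_riemann_stieltjes_op_le[OF p assms(5)] by blast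
  have main: "besov_integral p \<sigma> (riemann_stieltjes_op \<phi> f) \<le> ennreal (K * C * besov_norm p \<sigma> f powr p)"
    if f: "f \<in> besov_space p \<sigma>" for f :: "complex ^ 'n \<Rightarrow> complex"
  proof -
    have hf: "holomorphic_ball f" using f by (simp add: besov_space_def)
    have "besov_integral p \<sigma> (riemann_stieltjes_op \<phi> f)
        \<le> ennreal K * (\<integral>\<^sup>+ z. ennreal (norm (f z) powr p) \<partial>symbol_measure p \<sigma> \<phi>)"
      unfolding nn_integral_symbol_measure[OF hf \<phi>] by (rule op[OF \<phi> hf])
    also have "\<dots> \<le> ennreal K * ennreal (C * besov_norm p \<sigma> f powr p)"
      by (intro mult_left_mono carleson f) simp
    finally show ?thesis using K C by (simp add: ennreal_mult[symmetric] mult.assoc)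
  qed
  show "besov_bounded p \<sigma> (riemann_stieltjes_op \<phi>)"
    unfolding besov_bounded_def
  proof (intro conjI ballI exI[of _ "(K * C) powr (1 / p)"])
    fix f :: "complex ^ 'n \<Rightarrow> complex" assume f: "f \<in> besov_space p \<sigma>"
    have hf: "holomorphic_ball f" using f by (simp add: besov_space_def)
    let ?F = "riemann_stieltjes_op \<phi> f"
    show "?F \<in> besov_space p \<sigma>"
      using main[OF f] holomorphic_ball_riemann_stieltjes_op[OF \<phi> hf]
      by (auto simp: besov_space_def intro: le_less_trans)
    have "enn2real (besov_integral p \<sigma> ?F) \<le> K * C * besov_norm p \<sigma> f powr p"
      using main[OF f] K C by (intro enn2real_leI) auto
    then have "besov_norm p \<sigma> ?F powr p \<le> K * C * besov_norm p \<sigma> f powr p"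
      using p by (simp add: besov_norm_powr riemann_stieltjes_op_0)
    then have "(besov_norm p \<sigma> ?F powr p) powr (1 / p) \<le> (K * C * besov_norm p \<sigma> f powr p) powr (1 / p)"
      using p by (intro powr_mono2) auto
    then show "besov_norm p \<sigma> ?F \<le> (K * C) powr (1 / p) * besov_norm p \<sigma> f"
      using p K C by (simp add: powr_mult powr_powr besov_norm_def)
  qed (use K C in simp)
qed

end
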